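(* Let $\lambda_1,\lambda_2>0$ and $\mu_2\ge 0$, let $\mathbf d=(\mathbf d_t)_{t\in\mathbb N}$ be the discrete-time in-degree Markov chain with parameters $\lambda_1,\lambda_2,\mu_2$ defined in the context, and for each $t\in\mathbb N$ let $d(V_t)$ be the in-degree of a uniformly chosen vertex, as defined in the context. Then the limits $p_j:=\lim_{t\to\infty}\mathbb P(d(V_t)=j)$, $j\in\mathbb N$, exist and are as follows: (i) If $\mu_2=0$, then $p_0=0$ and $$p_j=\frac{\lambda_1}{\lambda_2}\,\mathbf B\Big(j,1+\frac{\lambda_1}{\lambda_2}\Big),\qquad j\in\mathbb N\setminus\{0\}.$$ (ii) If $\mu_2>0$ and $\lambda_2>\mu_2$, then $$p_0=\frac{\mu_2\lambda_1}{\lambda_2(\lambda_2-\mu_2)}\,\mathbf B\Big(2,\frac{\lambda_1}{\lambda_2-\mu_2}\Big)\,{}_2\mathbf F_1\Big(1,\frac{\lambda_1}{\lambda_2-\mu_2},2+\frac{\lambda_1}{\lambda_2-\mu_2},\frac{\mu_2}{\lambda_2}\Big)$$ and, for $j\in\mathbb N\setminus\{0\}$, $$p_j=\frac{\lambda_1(\lambda_2-\mu_2)}{\lambda_2^2}\,\mathbf B\Big(j,1+\frac{\lambda_1}{\lambda_2-\mu_2}\Big)\,{}_2\mathbf F_1\Big(j+1,1+\frac{\lambda_1}{\lambda_2-\mu_2},j+1+\frac{\lambda_1}{\lambda_2-\mu_2},\frac{\mu_2}{\lambda_2}\Big).$$ (iii) If $\mu_2>0$ and $\lambda_2<\mu_2$,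 then $$p_0=\frac{\lambda_1}{\mu_2-\lambda_2}\,\mathbf B\Big(2,\frac{\lambda_1}{\mu_2-\lambda_2}\Big)\,{}_2\mathbf F_1\Big(1,\frac{\lambda_1}{\mu_2-\lambda_2},2+\frac{\lambda_1}{\mu_2-\lambda_2},\frac{\lambda_2}{\mu_2}\Big)$$ and, for $j\in\mathbb N\setminus\{0\}$, $$p_j=\Big(\frac{\lambda_2}{\mu_2}\Big)^{j+1}\frac{\lambda_1(\mu_2-\lambda_2)}{\mu_2^2}\,\mathbf B\Big(j,1+\frac{\lambda_1}{\mu_2-\lambda_2}\Big)\,{}_2\mathbf F_1\Big(j+1,1+\frac{\lambda_1}{\mu_2-\lambda_2},j+1+\frac{\lambda_1}{\mu_2-\lambda_2},\frac{\lambda_2}{\mu_2}\Big).$$ (iv) If $\mu_2>0$ and $\lambda_2=\mu_2$, then $$p_0=\mathbf U\Big(1,0,\frac{\lambda_1}{\lambda_2}\Big)\quad\text{and}\quad p_j=\frac{\lambda_1}{\lambda_2}\,\Gamma(j)\,\mathbf U\Big(j,0,\frac{\lambda_1}{\lambda_2}\Big),\qquad j\in\mathbb N\setminus\{0\}.$$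
   Context: $\mathbb N=\{0,1,2,\dots\}$. $\Gamma$ is the Euler gamma function. Special functions: the Beta function $\mathbf B(a,b)=\int_0^1 s^{a-1}(1-s)^{b-1}\,ds$, $a,b>0$; the confluent hypergeometric function $\mathbf U(a,b,z)=\frac1{\Gamma(a)}\int_0^\infty e^{-zs}s^{a-1}(1+s)^{b-a-1}\,ds$ for $a>0$, $b\ge0$, $z>0$; the Gauss hypergeometric function ${}_2\mathbf F_1(a,b,c,z)=\frac1{\mathbf B(b,c-b)}\int_0^1 s^{b-1}\frac{(1-s)^{c-b-1}}{(1-sz)^a}\,ds$ for $a>0$, $c>b>0$, $0<z<1$. State space: $S:=\bigcup_{n\ge 1}\mathbb N^n$. For $\mathbf x=(x^1,\dots,x^n)\in\mathbb N^n\subset S$ write $\ell(\mathbf x):=n$ (the length) and $\|\mathbf x\|:=\sum_{j=1}^{\ell(\mathbf x)}x^j$. The in-degree chain with parameters $\lambda_1,\lambda_2>0$, $\mu_2\ge0$: $\mathbf d=(\mathbf d_t)_{t\in\mathbb N}$, $\mathbf d_t=(d_t^1,\dots,d_t^{\ell(\mathbf d_t)})$, is the discrete-time Markov chain on $S$, on a probability space $(\Omega,\mathcal F,\mathbb P)$, with $\mathbf d_0=(1)$ (the sequence of length one with entry $1$) and the following transition probabilities. Put $D(\mathbf x)=(\lambda_2+\mu_2)\|\mathbf x\|+\ell(\mathbf x)\lambda_1$. From $\mathbf x\in S$ the chain moves - to $(x^1,\dots,x^{i-1},x^i+1,x^{i+1},\dots,x^{\ell(\mathbf x)})$ with probability $x^i\lambda_2/D(\mathbf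 x)$, for each $1\le i\le\ell(\mathbf x)$; - to $(x^1,\dots,x^{i-1},x^i-1,x^{i+1},\dots,x^{\ell(\mathbf x)})$ with probability $x^i\mu_2/D(\mathbf x)$, for each $1\le i\le\ell(\mathbf x)$ (this is $0$ when $x^i=0$); - to $(x^1,\dots,x^{\ell(\mathbf x)},1)$ with probability $\ell(\mathbf x)\lambda_1/D(\mathbf x)$; all other transitions have probability $0$. (Here $\mathbf d_t$ is the vector of vertex in-degrees of a random directed graph with vertex set $V_t=\{1,\dots,\ell(\mathbf d_t)\}$.) $d(V_t)$ is a random variable with values in $\mathbb N$ whose law is determined by the conditional distributions $$\mathbb P(d(V_t)=j\mid \ell(\mathbf d_t)=n)=\frac1n\sum_{i=1}^n\mathbb P(d_t^i=j\mid \ell(\mathbf d_t)=n)$$ for all $j\in\mathbb N$ and all $n\ge1$ with $\mathbb P(\ell(\mathbf d_t)=n)>0$; i.e. it is the in-degree of a vertex chosen uniformly at random at time $t$.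
   Formalization: In (iii), for j ≥ 1, the factor (λ2/μ2)^(j+1) is replaced by (λ2/μ2)^(j-1); the printed exponent is wrong: as λ2→0 it gives p_1→0, whereas the true limit is λ1/(λ1+μ2). *)

theory Defs
  imports "HOL-Probability.Probability"
begin

text \<open>
  The library defines \<open>Beta\<close> through \<open>Gamma\<close>; for positive arguments it is the Euler integral.
\<close>

lemma Beta_eq_integral:
  fixes a b :: real
  assumes "a > 0" "b > 0"
  shows "Beta a b = integral {0..1} (\<lambda>s. s powr (a - 1) * (1 - s) powr (b - 1))"
  using has_integral_Beta_real[OF assms] by (simp add: integral_unique)

text \<open>Intended for \<open>a > 0\<close>, \<open>b \<ge> 0\<close>, \<open>z > 0\<close>.\<close>

definition confluent_U :: "real \<Rightarrow> real \<Rightarrow> real \<Rightarrow> real" where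
  "confluent_U a b z =
     1 / Gamma a * integral {0..} (\<lambda>s. exp (- z * s) * s powr (a - 1) * (1 + s) powr (b - a - 1))"

text \<open>Intended for \<open>a > 0\<close>, \<open>c > b > 0\<close>, \<open>0 < z < 1\<close>.\<close>

definition gauss_F :: "real \<Rightarrow> real \<Rightarrow> real \<Rightarrow> real \<Rightarrow> real" where
  "gauss_F a b c z =
     1 / Beta b (c - b) *
       integral {0..1} (\<lambda>s. s powr (b - 1) * ((1 - s) powr (c - b - 1) / (1 - s * z) powr a))"

text \<open>
  States are nonempty lists of naturals; entry \<open>x ! i\<close> is the in-degree of vertex \<open>i + 1\<close>.
\<close>

definition indeg_states :: "nat list set" where
  "indeg_states = {x. x \<noteq> []}"

definition indeg_total_rate :: "real \<Rightarrow> real \<Rightarrow> real \<Rightarrow> nat list \<Rightarrow> real" where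
  "indeg_total_rate lam1 lam2 mu2 x =
     (lam2 + mu2) * real (sum_list x) + real (length x) * lam1"

text \<open>
  The target states with nonzero weight are pairwise distinct, so at most one summand contributes.
  The truncated \<open>x ! i - 1\<close> at \<open>x ! i = 0\<close> carries weight \<open>0\<close>.
\<close>

definition indeg_trans :: "real \<Rightarrow> real \<Rightarrow> real \<Rightarrow> nat list \<Rightarrow> nat list \<Rightarrow> real" where
  "indeg_trans lam1 lam2 mu2 x y =
     (\<Sum>i<length x. if y = x[i := x ! i + 1]
        then real (x ! i) * lam2 / indeg_total_rate lam1 lam2 mu2 x else 0)
   + (\<Sum>i<length x. if y = x[i := x ! i - 1]
        then real (x ! i) * mu2 / indeg_total_rate lam1 lam2 mu2 x else 0)
   + (if y = x @ [1]
        then real (length x) * lam1 / indeg_total_rate lam1 lam2 mu2 x else 0)"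

definition indegree_chain ::
  "'a measure \<Rightarrow> real \<Rightarrow> real \<Rightarrow> real \<Rightarrow> (nat \<Rightarrow> 'a \<Rightarrow> nat list) \<Rightarrow> bool" where
  "indegree_chain M lam1 lam2 mu2 d \<longleftrightarrow>
     prob_space M \<and>
     (\<forall>t. d t \<in> measurable M (count_space indeg_states)) \<and>
     (AE \<omega> in M. d 0 \<omega> = [1]) \<and>
     (\<forall>t h. \<forall>y\<in>indeg_states.
        \<P>(\<omega> in M. \<forall>s\<le>t. d s \<omega> = h s) > 0 \<longrightarrow>
        \<P>(\<omega> in M. d (Suc t) \<omega> = y \<bar> \<forall>s\<le>t. d s \<omega> = h s) = indeg_trans lam1 lam2 mu2 (h t) y)"

text \<open>
  \<open>X\<close> is the random in-degree vector at a fixed time and \<open>Y\<close> the in-degree of a uniformly chosen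
  vertex. Only the conditional law of \<open>Y\<close> given the number of vertices is prescribed. \<open>Y\<close> lives on
  the same space as \<open>X\<close>, since that law conditions on the length of \<open>X\<close>.
\<close>

definition uniform_vertex_indegree ::
  "'a measure \<Rightarrow> ('a \<Rightarrow> nat list) \<Rightarrow> ('a \<Rightarrow> nat) \<Rightarrow> bool" where
  "uniform_vertex_indegree M X Y \<longleftrightarrow>
     Y \<in> measurable M (count_space UNIV) \<and>
     (\<forall>j. \<forall>n\<ge>1. \<P>(\<omega> in M. length (X \<omega>) = n) > 0 \<longrightarrow>
        \<P>(\<omega> in M. Y \<omega> = j \<bar> length (X \<omega>) = n) =
          1 / real n * (\<Sum>i<n. \<P>(\<omega> in M. X \<omega> ! i = j \<bar> length (X \<omega>) = n)))"

end

theory Submission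
  imports Defs
begin

text \<open>
  In the time scale in which one step from state \<open>x\<close> takes time \<open>1 / D(x)\<close>, every vertex carries a
  linear birth-death process with birth rate \<open>lam2\<close> and death rate \<open>mu2\<close> started from one individual,
  and the number of vertices grows at rate \<open>lam1\<close>. The age of a uniform vertex is then asymptotically
  exponential with rate \<open>lam1\<close>, so \<open>p j\<close> is the integral of \<open>lam1 * exp (- lam1 * a)\<close> times the
  probability that the birth-death process is in \<open>j\<close> at time \<open>a\<close>; the substitution
  \<open>s = exp (- \<bar>lam2 - mu2\<bar> * a)\<close> turns this integral into the Beta and hypergeometric functions.

  For the convergence let \<open>\<Phi> x y\<close> be the empirical generating function of the entries of \<open>x\<close>, let
  \<open>F\<close> solve \<open>F' = (1 - F) * (mu2 - lam2 * F)\<close> with \<open>F 0 = z\<close>, and let \<open>\<gamma>\<close> be the bounded solution of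
  \<open>\<gamma>' = lam1 * (\<gamma> - F)\<close>. Along the flow \<open>F\<close> the drift of \<open>\<Phi> x (F s) - \<gamma> s\<close> becomes a derivative in
  \<open>s\<close>, so that \<open>W x = \<integral> exp (- lam1 * s) * (\<Phi> x (F s) - \<gamma> s)\<^sup>2 ds\<close> has one-step drift at most
  \<open>(- lam1 * W x + C / length x) / D(x)\<close>. The drift of \<open>1 / length x\<close> makes the error term summable,
  and \<open>D\<close> grows at most linearly in time, so the divergence of the harmonic series forces the mean of
  \<open>W\<close> to \<open>0\<close>. As the integrand is Lipschitz in \<open>s\<close>, \<open>\<Phi> x z\<close> converges in mean to \<open>\<gamma> 0\<close>, which is
  the generating function of \<open>p\<close>.
\<close>

subsection \<open>The empirical generating function\<close>

lemma sum_nth_list_update: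
  fixes f :: "'b \<Rightarrow> real"
  assumes "i < length x"
  shows "(\<Sum>j<length x. f (x[i := k] ! j)) = (\<Sum>j<length x. f (x ! j)) + (f k - f (x ! i))"
proof -
  have "(\<Sum>j<length x. f (x[i := k] ! j)) = f k + (\<Sum>j\<in>{..<length x} - {i}. f (x ! j))"
    using assms by (subst sum.remove[of _ i]) (auto intro!: sum.cong)
  moreover have "(\<Sum>j<length x. f (x ! j)) = f (x ! i) + (\<Sum>j\<in>{..<length x} - {i}. f (x ! j))"
    using assms by (subst sum.remove[of _ i]) auto
  ultimately show ?thesis by simp
qed

text \<open>Each of the \<open>k\<close> copies of \<open>y ^ (k - 1)\<close> is at most the
  matching term of \<open>1 + y + ... + y ^ (k - 1)\<close>, and multiplying by \<open>1 - y\<close>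
  telescopes that sum. The bound is uniform in \<open>k\<close>, which keeps the drift estimates
  independent of the in-degrees.\<close>

lemma mult_power_one_minus_le_one:
  fixes y :: real
  assumes "0 \<le> y" "y \<le> 1"
  shows "real k * y ^ (k - 1) * (1 - y) \<le> 1"
proof (cases k)
  case (Suc n)
  have "real k * y ^ n * (1 - y) = (\<Sum>i<k. y ^ n) * (1 - y)" by simp
  also have "\<dots> \<le> (\<Sum>i<k. y ^ i) * (1 - y)"
    using assms Suc by (intro mult_right_mono sum_mono power_decreasing) auto
  also have "\<dots> = 1 - y ^ k" by (simp add: one_diff_power_eq mult.commute)
  also have "\<dots> \<le> 1" using assms by simp
  finally show ?thesis using Suc by simp
qed simp

definition degree_pgf :: "nat list \<Rightarrow> real \<Rightarrow> real" where
  "degree_pgf x y = (\<Sum>i<length x. y ^ (x ! i)) / real (length x)"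

definition degree_pgf_deriv :: "nat list \<Rightarrow> real \<Rightarrow> real" where
  "degree_pgf_deriv x y = (\<Sum>i<length x. real (x ! i) * y ^ (x ! i - 1)) / real (length x)"

lemma has_real_derivative_degree_pgf:
  "(degree_pgf x has_real_derivative degree_pgf_deriv x y) (at y)"
  unfolding degree_pgf_def degree_pgf_deriv_def
  by (cases "x = []") (auto intro!: derivative_eq_intros simp: sum_divide_distrib)

lemma degree_pgf_bounds:
  assumes "0 \<le> y" "y \<le> 1"
  shows "0 \<le> degree_pgf x y" "degree_pgf x y \<le> 1"
proof -
  show "0 \<le> degree_pgf x y" using assms by (auto simp: degree_pgf_def intro!: sum_nonneg divide_nonneg_nonneg)
  have "(\<Sum>i<length x. y ^ (x ! i)) \<le> (\<Sum>i<length x. 1)"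
    using assms by (intro sum_mono power_le_one)
  then show "degree_pgf x y \<le> 1" by (auto simp: degree_pgf_def divide_le_eq_1)
qed

lemma degree_pgf_deriv_bounds:
  assumes "0 \<le> y" "y \<le> 1"
  shows "0 \<le> degree_pgf_deriv x y" "(1 - y) * degree_pgf_deriv x y \<le> 1"
proof -
  show "0 \<le> degree_pgf_deriv x y"
    using assms by (auto simp: degree_pgf_deriv_def intro!: sum_nonneg divide_nonneg_nonneg)
  have "(\<Sum>i<length x. real (x ! i) * y ^ (x ! i - 1) * (1 - y)) \<le> (\<Sum>i<length x. 1)"
    using assms by (intro sum_mono mult_power_one_minus_le_one)
  then show "(1 - y) * degree_pgf_deriv x y \<le> 1"
    by (auto simp: degree_pgf_deriv_def divide_le_eq_1 sum_distrib_left[symmetric] sum_distrib_right[symmetric] mult_ac)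
qed

lemma degree_pgf_list_update:
  assumes "i < length x"
  shows "degree_pgf (x[i := k]) y = degree_pgf x y + (y ^ k - y ^ (x ! i)) / real (length x)"
  using sum_nth_list_update[OF assms, of "\<lambda>k. y ^ k" k]
  by (simp add: degree_pgf_def add_divide_distrib)

lemma degree_pgf_snoc:
  assumes "x \<noteq> []"
  shows "degree_pgf (x @ [1]) y = degree_pgf x y + (y - degree_pgf x y) / (real (length x) + 1)"
proof -
  define n where "n = real (length x)"
  have n: "n > 0" using assms by (simp add: n_def)
  have "(\<Sum>i<length (x @ [1]). y ^ ((x @ [1]) ! i)) = (\<Sum>i<length x. y ^ (x ! i)) + y"
    by (simp add: nth_append)
  then have "degree_pgf (x @ [1]) y = ((\<Sum>i<length x. y ^ (x ! i)) + y) / (n + 1)"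
    by (simp only: degree_pgf_def) (simp add: n_def add.commute)
  also have "\<dots> = degree_pgf x y + (y - degree_pgf x y) / (n + 1)"
    unfolding degree_pgf_def n_def[symmetric] using n
    by (simp add: divide_simps) (simp add: algebra_simps)
  finally show ?thesis by (simp add: n_def)
qed

section \<open>The generator and the drift of squared deviations\<close>

locale indegree_params =
  fixes lam1 lam2 mu2 :: real
  assumes lam1_pos: "lam1 > 0" and lam2_pos: "lam2 > 0" and mu2_nonneg: "mu2 \<ge> 0"
begin

abbreviation rate :: "nat list \<Rightarrow> real" where
  "rate \<equiv> indeg_total_rate lam1 lam2 mu2"

text \<open>The generator of the chain run in continuous time with total jump rate \<open>rate x\<close> in state \<open>x\<close>.\<close>

definition gen :: "(nat list \<Rightarrow> real) \<Rightarrow> nat list \<Rightarrow> real" where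
  "gen f x =
     (\<Sum>i<length x. real (x ! i) * lam2 * (f (x[i := x ! i + 1]) - f x))
   + (\<Sum>i<length x. real (x ! i) * mu2 * (f (x[i := x ! i - 1]) - f x))
   + real (length x) * lam1 * (f (x @ [1]) - f x)"

text \<open>Only the arrival of a vertex changes the length. This negative drift later pays for the
  error terms of order \<open>1 / length x\<close>.\<close>

lemma gen_inverse_length:
  assumes "x \<noteq> []"
  shows "gen (\<lambda>x. 1 / real (length x)) x = - lam1 / (real (length x) + 1)"
proof -
  define n where "n = real (length x)"
  have n: "n > 0" using assms by (simp add: n_def)
  have "n * lam1 * (1 / (n + 1) - 1 / n) = - lam1 / (n + 1)"
    using n by (simp add: divide_simps)
  then show ?thesis by (simp add: gen_def n_def add.commute)
qed

text \<open>The contribution of one vertex of in-degree \<open>k\<close> to the drift of a squared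
  deviation. The linear parts of its two jumps combine exactly to the first term on the right; the
  quadratic parts are bounded uniformly in \<open>k\<close>. For \<open>k = 0\<close> both jumps
  have weight \<open>0\<close>.\<close>

lemma vertex_jump_le:
  assumes y: "0 \<le> y" "y \<le> 1" and n: "n > 0"
  shows "real k * lam2 * ((c + (y ^ (k + 1) - y ^ k) / n)\<^sup>2 - c\<^sup>2)
       + real k * mu2 * ((c + (y ^ (k - 1) - y ^ k) / n)\<^sup>2 - c\<^sup>2)
       \<le> 2 * c * (1 - y) * (mu2 - lam2 * y) * (real k * y ^ (k - 1)) / n + (lam2 + mu2) / n\<^sup>2"
proof (cases k)
  case (Suc m)
  \<comment> \<open>As \<open>k = m + 1\<close>, a downward jump changes \<open>y ^ k\<close> by
    \<open>q\<close> and an upward jump by \<open>- (y * q)\<close>.\<close>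
  define q where "q = y ^ m * (1 - y)"
  have q: "0 \<le> q" "real k * q \<le> 1" "q \<le> 1"
    using y mult_power_one_minus_le_one[OF y, of k] Suc
    by (auto simp: q_def mult_ac intro!: mult_le_one power_le_one)
  have kq: "real k * q\<^sup>2 \<le> 1"
    using mult_mono[OF q(2) q(3)] q by (simp add: power2_eq_square mult_ac)
  have yq: "real k * (y * q)\<^sup>2 \<le> 1"
  proof -
    have "(y * q)\<^sup>2 \<le> q\<^sup>2" using y q by (intro power_mono) (auto intro: mult_left_le_one_le)
    then show ?thesis using kq by (meson mult_left_mono of_nat_0_le_iff order_trans)
  qed
  have e1: "y ^ (k + 1) - y ^ k = - (y * q)" and e2: "y ^ (k - 1) - y ^ k = q"
    using Suc by (auto simp: q_def algebra_simps)
  have e: "real k * lam2 * ((c + (y ^ (k + 1) - y ^ k) / n)\<^sup>2 - c\<^sup>2)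
       + real k * mu2 * ((c + (y ^ (k - 1) - y ^ k) / n)\<^sup>2 - c\<^sup>2)
     = 2 * c * (1 - y) * (mu2 - lam2 * y) * (real k * y ^ (k - 1)) / n
       + (lam2 * (real k * (y * q)\<^sup>2) + mu2 * (real k * q\<^sup>2)) / n\<^sup>2"
    unfolding e1 e2 using n Suc by (simp add: q_def field_simps power2_eq_square)
  have "lam2 * (real k * (y * q)\<^sup>2) + mu2 * (real k * q\<^sup>2) \<le> lam2 * 1 + mu2 * 1"
    using lam2_pos mu2_nonneg kq yq by (intro add_mono mult_left_mono) auto
  then show ?thesis unfolding e using n by (intro add_left_mono divide_right_mono) auto
qed (use lam2_pos mu2_nonneg in simp)

text \<open>Summing over \<open>n\<close> vertices turns the error
  \<open>(lam2 + mu2) / n\<^sup>2\<close> into \<open>(lam2 + mu2) / n\<close>. A new vertex shifts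
  the average \<open>f\<close> by \<open>(y - f) / (n + 1)\<close>: replacing
  \<open>n / (n + 1)\<close> by \<open>1\<close> costs at most \<open>2 / n\<close>, the squared
  shift at most \<open>1 / n\<close>, which explains \<open>3 * lam1\<close>.\<close>

lemma gen_square_le:
  assumes y: "0 \<le> y" "y \<le> 1" and g: "0 \<le> g" "g \<le> 1" and x: "x \<noteq> []"
  shows "gen (\<lambda>x. (degree_pgf x y - g)\<^sup>2) x \<le>
    2 * (degree_pgf x y - g) *
      ((1 - y) * (mu2 - lam2 * y) * degree_pgf_deriv x y + lam1 * (y - degree_pgf x y))
    + (lam2 + mu2 + 3 * lam1) / real (length x)"
proof -
  define n where "n = real (length x)"
  have n: "n > 0" using x by (simp add: n_def)
  define c where "c = degree_pgf x y - g"
  define f where "f = degree_pgf x y"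
  have fb: "0 \<le> f" "f \<le> 1" using degree_pgf_bounds[OF y] by (auto simp: f_def)
  have c: "\<bar>c\<bar> \<le> 1" using fb g by (auto simp: c_def f_def)
  have 1: "(\<Sum>i<length x. real (x ! i) * lam2 * ((degree_pgf (x[i := x ! i + 1]) y - g)\<^sup>2 - (degree_pgf x y - g)\<^sup>2))
    + (\<Sum>i<length x. real (x ! i) * mu2 * ((degree_pgf (x[i := x ! i - 1]) y - g)\<^sup>2 - (degree_pgf x y - g)\<^sup>2))
    \<le> 2 * c * (1 - y) * (mu2 - lam2 * y) * degree_pgf_deriv x y + (lam2 + mu2) / n"
    (is "?A \<le> _")
  proof -
    have "?A = (\<Sum>i<length x. real (x ! i) * lam2 * ((c + (y ^ (x ! i + 1) - y ^ (x ! i)) / n)\<^sup>2 - c\<^sup>2)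
       + real (x ! i) * mu2 * ((c + (y ^ (x ! i - 1) - y ^ (x ! i)) / n)\<^sup>2 - c\<^sup>2))"
      unfolding sum.distrib
      by (intro arg_cong2[where f="(+)"] sum.cong refl)
         (simp_all add: degree_pgf_list_update c_def n_def algebra_simps)
    also have "\<dots> \<le> (\<Sum>i<length x. 2 * c * (1 - y) * (mu2 - lam2 * y) * (real (x ! i) * y ^ (x ! i - 1)) / n
       + (lam2 + mu2) / n\<^sup>2)"
      by (intro sum_mono vertex_jump_le y n)
    also have "\<dots> = 2 * c * (1 - y) * (mu2 - lam2 * y) * degree_pgf_deriv x y + n * ((lam2 + mu2) / n\<^sup>2)"
      by (simp add: sum.distrib degree_pgf_deriv_def n_def sum_distrib_left sum_divide_distrib mult_ac)
    also have "n * ((lam2 + mu2) / n\<^sup>2) = (lam2 + mu2) / n"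
      using n by (simp add: power2_eq_square)
    finally show ?thesis .
  qed
  have 2: "n * lam1 * ((degree_pgf (x @ [1]) y - g)\<^sup>2 - (degree_pgf x y - g)\<^sup>2)
      \<le> 2 * c * lam1 * (y - f) + 3 * lam1 / n"
  proof -
    have d: "\<bar>y - f\<bar> \<le> 1" using fb y by auto
    have "n * ((degree_pgf (x @ [1]) y - g)\<^sup>2 - (degree_pgf x y - g)\<^sup>2)
        = n * (2 * c * ((y - f) / (n + 1)) + ((y - f) / (n + 1))\<^sup>2)"
      unfolding degree_pgf_snoc[OF x] by (simp add: c_def f_def n_def[symmetric] power2_eq_square algebra_simps)
    also have "\<dots> = 2 * c * (y - f) - 2 * (c * (y - f)) / (n + 1) + n * (y - f)\<^sup>2 / (n + 1)\<^sup>2"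
      using n by (simp add: field_simps power2_eq_square add_eq_0_iff)
    also have "\<dots> \<le> 2 * c * (y - f) + 2 / n + 1 / n"
    proof -
      have "\<bar>c * (y - f)\<bar> \<le> 1" using mult_mono[OF c d] by (simp add: abs_mult)
      then have "- 2 * (c * (y - f)) / (n + 1) \<le> 2 / (n + 1)" using n by (intro divide_right_mono) auto
      also have "\<dots> \<le> 2 / n" using n by (intro divide_left_mono) auto
      finally have a: "- 2 * (c * (y - f)) / (n + 1) \<le> 2 / n" .
      have "(y - f)\<^sup>2 \<le> 1" using d by (simp add: abs_square_le_1)
      then have "n * (y - f)\<^sup>2 / (n + 1)\<^sup>2 \<le> n * 1 / (n + 1)\<^sup>2" using n by (intro divide_right_mono mult_left_mono) auto
      also have "\<dots> \<le> 1 / n" using n by (simp add: divide_simps power2_eq_square) (simp add: algebra_simps)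
      finally show ?thesis using a by simp
    qed
    finally have "n * ((degree_pgf (x @ [1]) y - g)\<^sup>2 - (degree_pgf x y - g)\<^sup>2) \<le> 2 * c * (y - f) + 3 / n" by simp
    from mult_left_mono[OF this, of lam1] show ?thesis using lam1_pos by (simp add: algebra_simps)
  qed
  have 3: "2 * c * ((1 - y) * (mu2 - lam2 * y) * degree_pgf_deriv x y + lam1 * (y - f))
      + (lam2 + mu2 + 3 * lam1) / n
    = 2 * c * (1 - y) * (mu2 - lam2 * y) * degree_pgf_deriv x y + (lam2 + mu2) / n
      + (2 * c * lam1 * (y - f) + 3 * lam1 / n)"
    by (simp add: algebra_simps add_divide_distrib)
  show ?thesis using add_mono[OF 1 2]
    unfolding 3[symmetric] unfolding gen_def n_def f_def c_def by (simp only:)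
qed

end

subsection \<open>The flow and its resolvent\<close>

lemma integrable_on_exp_times_bounded:
  fixes f :: "real \<Rightarrow> real"
  assumes r: "r > 0" and f: "continuous_on {0..} f" and b: "\<And>s. s \<ge> 0 \<Longrightarrow> \<bar>f s\<bar> \<le> B"
  shows "(\<lambda>s. exp (- r * s) * f s) absolutely_integrable_on {0..}"
proof (rule measurable_bounded_by_integrable_imp_absolutely_integrable)
  show "(\<lambda>s. exp (- r * s) * f s) \<in> borel_measurable (lebesgue_on {0..})"
    by (intro continuous_imp_measurable_on_sets_lebesgue continuous_intros f) auto
  show "(\<lambda>s. exp (- r * s) * B) integrable_on {0..}"
    using integrable_on_exp_minus_to_infinity[OF r] by (rule integrable_on_mult_left)
  show "norm (exp (- r * s) * f s) \<le> exp (- r * s) * B" if "s \<in> {0..}" for s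
    using b that by (auto simp: abs_mult intro!: mult_left_mono)
qed auto

lemma has_integral_exp_density:
  fixes r :: real
  assumes "r > 0"
  shows "((\<lambda>s. r * exp (- r * s)) has_integral 1) {0..}"
  using has_integral_mult_right[OF has_integral_exp_minus_to_infinity[OF assms, of 0], of r] assms
  by simp

text \<open>The fundamental theorem on \<open>{0..k}\<close>, then dominated convergence as
  \<open>k\<close> tends to infinity, with \<open>h\<close> as dominating function.\<close>

lemma has_integral_FTC_to_infinity:
  fixes F f h :: "real \<Rightarrow> real"
  assumes F: "\<And>s. s \<ge> 0 \<Longrightarrow> (F has_real_derivative f s) (at s within {0..})"
    and h: "h integrable_on {0..}" and le: "\<And>s. s \<ge> 0 \<Longrightarrow> \<bar>f s\<bar> \<le> h s"
    and lim: "(F \<longlongrightarrow> T) at_top"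
  shows "(f has_integral T - F 0) {0..}"
proof (rule has_integral_dominated_convergence[where f = "\<lambda>k s. if s \<in> {0..real k} then f s else 0"
        and y = "\<lambda>k. F (real k) - F 0"])
  fix k :: nat
  have "(f has_integral F (real k) - F 0) {0..real k}"
  proof (rule fundamental_theorem_of_calculus)
    fix s assume s: "s \<in> {0..real k}"
    show "(F has_vector_derivative f s) (at s within {0..real k})"
      using F[of s] s unfolding has_real_derivative_iff_has_vector_derivative
      by (auto intro: has_vector_derivative_within_subset)
  qed simp
  then show "((\<lambda>s. if s \<in> {0..real k} then f s else 0) has_integral F (real k) - F 0) {0..}"
    by (subst has_integral_restrict) auto
  show "\<forall>s\<in>{0..}. norm (if s \<in> {0..real k} then f s else 0) \<le> h s"
    using le by (auto intro: order_trans[OF abs_ge_zero])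
next
  show "\<forall>s\<in>{0..}. (\<lambda>k. if s \<in> {0..real k} then f s else 0) \<longlonglongrightarrow> f s"
  proof
    fix s :: real assume s: "s \<in> {0..}"
    obtain k0 where k0: "s \<le> real k0" using real_arch_simple by blast
    have "\<forall>\<^sub>F k in sequentially. (if s \<in> {0..real k} then f s else 0) = f s"
      using eventually_ge_at_top[of k0] by eventually_elim (use s k0 in auto)
    then show "(\<lambda>k. if s \<in> {0..real k} then f s else 0) \<longlonglongrightarrow> f s"
      by (rule tendsto_eventually)
  qed
  show "(\<lambda>k. F (real k) - F 0) \<longlonglongrightarrow> T - F 0"
    by (intro tendsto_intros filterlim_compose[OF lim] filterlim_real_sequentially)
qed (use h in auto)

text \<open>The bounded solution of \<open>\<gamma>' = r (\<gamma> - f)\<close>.\<close>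

definition resolvent :: "real \<Rightarrow> (real \<Rightarrow> real) \<Rightarrow> real \<Rightarrow> real" where
  "resolvent r f s = exp (r * s) *
     (integral {0..} (\<lambda>a. r * exp (- r * a) * f a) - integral {0..s} (\<lambda>a. r * exp (- r * a) * f a))"

lemma resolvent_0: "resolvent r f 0 = integral {0..} (\<lambda>a. r * exp (- r * a) * f a)"
  by (simp add: resolvent_def)

lemma has_real_derivative_resolvent:
  assumes f: "continuous_on {0..} f" and s: "s \<ge> 0"
  shows "(resolvent r f has_real_derivative r * (resolvent r f s - f s)) (at s within {0..})"
proof -
  have "continuous_on {0..s+1} (\<lambda>a. r * exp (- r * a) * f a)"
    by (intro continuous_intros continuous_on_subset[OF f]) auto
  then have "((\<lambda>s. integral {0..s} (\<lambda>a. r * exp (- r * a) * f a)) has_real_derivative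
      r * exp (- r * s) * f s) (at s within {0..s+1})"
    using s by (intro integral_has_real_derivative) auto
  \<comment> \<open>The fundamental theorem was applied on a compact interval; near \<open>s\<close>
    that interval and the half line coincide.\<close>
  also have "at s within {0..s+1} = at s within {0..}"
    using s by (intro at_within_nhd[of _ "{..<s+1}"]) auto
  finally have d: "((\<lambda>s. integral {0..s} (\<lambda>a. r * exp (- r * a) * f a)) has_real_derivative
      r * exp (- r * s) * f s) (at s within {0..})" .
  have e: "((\<lambda>s. exp (r * s)) has_real_derivative exp (r * s) * r) (at s within {0..})"
    by (auto intro!: derivative_eq_intros)
  have h: "(0 - r * exp (- r * s) * f s) * exp (r * s) = - r * f s"
    by (simp add: exp_minus)
  show ?thesis
    unfolding resolvent_def[abs_def]
    by (rule DERIV_cong[OF DERIV_mult[OF e DERIV_diff[OF DERIV_const d]]], unfold h)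
       (simp add: algebra_simps)
qed

text \<open>\<open>resolvent r f s\<close> is the integral of
  \<open>r * exp (- r * (a - s)) * f a\<close> over \<open>a \<ge> s\<close>, an average of
  \<open>f\<close> under an exponential law started at \<open>s\<close>, so it inherits the bounds
  of \<open>f\<close>. The lower bound compares the integrals of \<open>w\<close> over
  \<open>{0..s}\<close> and \<open>{0..}\<close>, the upper bound those of
  \<open>e - w\<close>.\<close>

lemma resolvent_bounds:
  assumes r: "r > 0" and f: "continuous_on {0..} f" and b: "\<And>s. s \<ge> 0 \<Longrightarrow> 0 \<le> f s \<and> f s \<le> 1"
    and s: "s \<ge> 0"
  shows "0 \<le> resolvent r f s" "resolvent r f s \<le> 1"
proof -
  define w where "w = (\<lambda>a. r * exp (- r * a) * f a)"
  define e where "e = (\<lambda>a. r * exp (- r * a))"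
  have w: "w integrable_on {0..}"
    using set_lebesgue_integral_eq_integral(1)[OF integrable_on_exp_times_bounded[OF r f, of 1]] b
    unfolding w_def mult.assoc by (intro integrable_on_mult_right) force
  have ws: "w integrable_on {0..s}"
    using w by (rule integrable_on_subinterval) auto
  have e: "(e has_integral 1) {0..}" unfolding e_def by (rule has_integral_exp_density[OF r])
  have es: "(e has_integral 1 - exp (- r * s)) {0..s}"
  proof -
    have "(e has_integral - exp (- r * s) - - exp (- r * 0)) {0..s}"
      unfolding e_def using s
      by (intro fundamental_theorem_of_calculus)
         (auto intro!: derivative_eq_intros simp flip: has_real_derivative_iff_has_vector_derivative)
    then show ?thesis by simp
  qed
  have w0: "0 \<le> w a" "w a \<le> e a" if "a \<ge> 0" for a
    using b[OF that] r by (auto simp: w_def e_def mult_left_le)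
  have 1: "integral {0..s} w \<le> integral {0..} w"
    using ws w w0 by (intro integral_subset_le) auto
  then show "0 \<le> resolvent r f s" by (simp add: resolvent_def w_def)
  have "integral {0..s} (\<lambda>a. e a - w a) \<le> integral {0..} (\<lambda>a. e a - w a)"
    using ws w w0 e[THEN has_integral_integrable] es[THEN has_integral_integrable]
    by (intro integral_subset_le integrable_diff) auto
  then have "1 - exp (- r * s) - integral {0..s} w \<le> 1 - integral {0..} w"
    using ws w integral_unique[OF e] integral_unique[OF es]
      e[THEN has_integral_integrable] es[THEN has_integral_integrable]
    by (simp add: integral_diff)
  then have "integral {0..} w - integral {0..s} w \<le> exp (- r * s)" by simp
  then have "exp (r * s) * (integral {0..} w - integral {0..s} w) \<le> exp (r * s) * exp (- r * s)"
    by (intro mult_left_mono) auto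
  then show "resolvent r f s \<le> 1" by (simp add: resolvent_def w_def flip: exp_add)
qed

section \<open>The generating function of the linear birth-death process\<close>

context indegree_params
begin

abbreviation growth :: real where "growth \<equiv> lam2 - mu2"

text \<open>The integral of the mean population \<open>exp (growth * u)\<close> over
  \<open>u\<close> from \<open>0\<close> to \<open>a\<close>. The case distinction lets the three
  signs of \<open>growth\<close> share all later formulas.\<close>

definition mean_integral :: "real \<Rightarrow> real" where
  "mean_integral a = (if growth = 0 then a else (exp (growth * a) - 1) / growth)"

lemma exp_growth: "exp (growth * a) = 1 + growth * mean_integral a"
  by (auto simp: mean_integral_def)

lemma mean_integral_0 [simp]: "mean_integral 0 = 0"
  by (simp add: mean_integral_def)

lemma has_real_derivative_mean_integral [derivative_intros]:
  assumes "(f has_real_derivative f') (at a within S)"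
  shows "((\<lambda>a. mean_integral (f a)) has_real_derivative exp (growth * f a) * f') (at a within S)"
  using assms unfolding mean_integral_def
  by (cases "lam2 = mu2") (auto intro!: derivative_eq_intros)

lemma continuous_on_mean_integral [continuous_intros]:
  "continuous_on S f \<Longrightarrow> continuous_on S (\<lambda>a. mean_integral (f a))"
  unfolding mean_integral_def by (cases "lam2 = mu2") (auto intro!: continuous_intros)

lemma mean_integral_nonneg: "a \<ge> 0 \<Longrightarrow> mean_integral a \<ge> 0"
  by (cases "growth > 0")
     (auto simp: mean_integral_def zero_le_divide_iff mult_le_0_iff zero_le_mult_iff)

text \<open>The probability generating function at \<open>z\<close> of the linear birth-death process at time \<open>a\<close>,
  started from one individual.\<close>

definition flow :: "real \<Rightarrow> real \<Rightarrow> real" where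
  "flow z a = 1 - (1 - z) * exp (growth * a) / (1 + lam2 * (1 - z) * mean_integral a)"

lemma flow_0 [simp]: "flow z 0 = z"
  by (simp add: flow_def)

lemma flow_denominator_pos:
  assumes "z \<le> 1" "a \<ge> 0"
  shows "1 + lam2 * (1 - z) * mean_integral a > 0"
  using assms lam2_pos mean_integral_nonneg[of a] by (intro add_pos_nonneg mult_nonneg_nonneg) auto

lemma flow_bounds:
  assumes z: "0 \<le> z" "z \<le> 1" and a: "a \<ge> 0"
  shows "0 \<le> flow z a" "flow z a \<le> 1"
proof -
  note d = flow_denominator_pos[OF z(2) a]
  have "(1 - z) * exp (growth * a) \<le> 1 + lam2 * (1 - z) * mean_integral a"
  proof -
    \<comment> \<open>This is the difference of the two sides, once \<open>exp_growth\<close> has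
      removed the exponential.\<close>
    have "0 \<le> z + (1 - z) * (mu2 * mean_integral a)"
      using z mu2_nonneg mean_integral_nonneg[OF a] by simp
    then show ?thesis unfolding exp_growth by (simp add: algebra_simps)
  qed
  then show "0 \<le> flow z a" using d by (simp add: flow_def)
  show "flow z a \<le> 1" using d z by (simp add: flow_def)
qed

text \<open>Since \<open>mean_integral\<close> has derivative \<open>E\<close>, the quotient rule
  for \<open>w = q * E / d\<close>, which is \<open>1 - flow z a\<close>, yields the derivative
  \<open>w * (lam2 * w - growth)\<close> of the flow, and
  \<open>lam2 * w - growth = mu2 - lam2 * flow z a\<close>.\<close>

lemma has_real_derivative_flow:
  assumes z: "z \<le> 1" and a: "a \<ge> 0"
  shows "(flow z has_real_derivative (1 - flow z a) * (mu2 - lam2 * flow z a)) (at a within S)"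
proof -
  define g where "g = mean_integral a"
  define d where "d = 1 + lam2 * (1 - z) * g"
  define q where "q = 1 - z"
  have d: "d > 0" using flow_denominator_pos[OF assms] by (simp add: d_def g_def)
  define E where "E = exp (growth * a)"
  have E: "E = 1 + growth * g" by (simp add: E_def g_def exp_growth)
  have "((\<lambda>a. 1 - q * exp (growth * a) / (1 + lam2 * q * mean_integral a)) has_real_derivative
      0 - (q * (E * growth) * d - q * E * (lam2 * q * E)) / (d * d)) (at a within S)"
    by (rule derivative_eq_intros refl)+
       (use d in \<open>simp_all add: q_def E_def d_def g_def mult_ac\<close>)
  then have "(flow z has_real_derivative
      0 - (q * (E * growth) * d - q * E * (lam2 * q * E)) / (d * d)) (at a within S)"
    by (simp only: flow_def[abs_def] q_def)
  also have "0 - (q * (E * growth) * d - q * E * (lam2 * q * E)) / (d * d)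
      = (q * E / d) * (lam2 * q * E / d) - q * (E * growth) / d"
    using d by (simp add: diff_divide_distrib)
  also have "\<dots> = (q * E / d) * (lam2 * (q * E / d) - growth)"
    by (simp add: right_diff_distrib mult_ac)
  also have "\<dots> = (1 - flow z a) * (mu2 - lam2 * flow z a)"
    by (simp add: flow_def q_def E_def d_def g_def right_diff_distrib)
  finally show ?thesis .
qed

lemma continuous_on_flow:
  assumes "z \<le> 1"
  shows "continuous_on {0..} (flow z)"
  by (rule DERIV_continuous_on[OF has_real_derivative_flow[OF assms]]) auto

subsection \<open>The Lyapunov function\<close>

definition fluctuation :: "real \<Rightarrow> nat list \<Rightarrow> real \<Rightarrow> real" where
  "fluctuation z x s = degree_pgf x (flow z s) - resolvent lam1 (flow z) s"

definition fluctuation_deriv :: "real \<Rightarrow> nat list \<Rightarrow> real \<Rightarrow> real" where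
  "fluctuation_deriv z x s = (1 - flow z s) * (mu2 - lam2 * flow z s) * degree_pgf_deriv x (flow z s)
     - lam1 * (resolvent lam1 (flow z) s - flow z s)"

definition lyap :: "real \<Rightarrow> nat list \<Rightarrow> real" where
  "lyap z x = integral {0..} (\<lambda>s. exp (- lam1 * s) * (fluctuation z x s)\<^sup>2)"

lemma has_real_derivative_fluctuation:
  assumes "z \<le> 1" "s \<ge> 0"
  shows "(fluctuation z x has_real_derivative fluctuation_deriv z x s) (at s within {0..})"
  using DERIV_diff[OF DERIV_chain2[OF has_real_derivative_degree_pgf has_real_derivative_flow[OF assms]]
      has_real_derivative_resolvent[OF continuous_on_flow[OF assms(1)] assms(2)]]
  by (simp add: fluctuation_def[abs_def] fluctuation_deriv_def mult_ac)

lemma continuous_on_fluctuation: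
  assumes "z \<le> 1"
  shows "continuous_on {0..} (fluctuation z x)"
  by (rule DERIV_continuous_on[OF has_real_derivative_fluctuation[OF assms]]) auto

lemma abs_fluctuation_le:
  assumes "0 \<le> z" "z \<le> 1" "s \<ge> 0"
  shows "\<bar>fluctuation z x s\<bar> \<le> 1"
proof -
  have f: "0 \<le> flow z a \<and> flow z a \<le> 1" if "a \<ge> 0" for a
    using flow_bounds[OF assms(1,2) that] by auto
  show ?thesis
    using resolvent_bounds[OF lam1_pos continuous_on_flow[OF assms(2)] f assms(3)]
      degree_pgf_bounds[of "flow z s" x] f[OF assms(3)]
    by (auto simp: fluctuation_def)
qed

text \<open>The derivative of the empirical generating function has no bound uniform in
  \<open>x\<close> near \<open>1\<close>, but the velocity of the flow carries the factor
  \<open>1 - y\<close> that compensates for it.\<close>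

lemma abs_fluctuation_deriv_le:
  assumes "0 \<le> z" "z \<le> 1" "s \<ge> 0"
  shows "\<bar>fluctuation_deriv z x s\<bar> \<le> lam1 + lam2 + mu2"
proof -
  have f: "0 \<le> flow z a \<and> flow z a \<le> 1" if "a \<ge> 0" for a
    using flow_bounds[OF assms(1,2) that] by auto
  define y where "y = flow z s"
  have y: "0 \<le> y" "y \<le> 1" using f[OF assms(3)] by (auto simp: y_def)
  have "\<bar>resolvent lam1 (flow z) s - y\<bar> \<le> 1"
    using resolvent_bounds[OF lam1_pos continuous_on_flow[OF assms(2)] f assms(3)] y by auto
  then have 1: "\<bar>lam1 * (resolvent lam1 (flow z) s - y)\<bar> \<le> lam1"
    using lam1_pos by (simp add: abs_mult mult_left_le)
  have "lam2 * y \<le> lam2" "lam2 * y \<ge> 0" using y lam2_pos by (auto simp: mult_left_le)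
  then have "\<bar>mu2 - lam2 * y\<bar> \<le> lam2 + mu2" using mu2_nonneg by linarith
  moreover have "\<bar>(1 - y) * degree_pgf_deriv x y\<bar> \<le> 1"
    using degree_pgf_deriv_bounds[OF y, of x] y by (simp add: abs_mult)
  ultimately have "\<bar>mu2 - lam2 * y\<bar> * \<bar>(1 - y) * degree_pgf_deriv x y\<bar> \<le> (lam2 + mu2) * 1"
    by (intro mult_mono) auto
  then have 2: "\<bar>(1 - y) * (mu2 - lam2 * y) * degree_pgf_deriv x y\<bar> \<le> lam2 + mu2"
    by (simp add: abs_mult mult_ac)
  show ?thesis using 1 2 unfolding fluctuation_deriv_def y_def by linarith
qed

lemma lyap_has_integral:
  assumes "0 \<le> z" "z \<le> 1"
  shows "((\<lambda>s. exp (- lam1 * s) * (fluctuation z x s)\<^sup>2) has_integral lyap z x) {0..}"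
  unfolding lyap_def
proof (intro integrable_integral set_lebesgue_integral_eq_integral(1) integrable_on_exp_times_bounded lam1_pos)
  show "continuous_on {0..} (\<lambda>s. (fluctuation z x s)\<^sup>2)"
    by (intro continuous_intros continuous_on_fluctuation assms)
  show "\<bar>(fluctuation z x s)\<^sup>2\<bar> \<le> 1" if "s \<ge> 0" for s
    using abs_fluctuation_le[OF assms that, of x] by (simp add: abs_square_le_1)
qed

lemma lyap_nonneg:
  assumes "0 \<le> z" "z \<le> 1"
  shows "0 \<le> lyap z x"
  by (rule has_integral_nonneg[OF lyap_has_integral[OF assms]]) auto

text \<open>In a fixed state \<open>gen\<close> is a finite linear combination of values, so it
  commutes with the integral over \<open>s\<close>.\<close>

lemma gen_lyap_has_integral:
  assumes "0 \<le> z" "z \<le> 1"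
  shows "((\<lambda>s. exp (- lam1 * s) * gen (\<lambda>x. (fluctuation z x s)\<^sup>2) x) has_integral gen (lyap z) x) {0..}"
proof -
  define f where "f = (\<lambda>x s. exp (- lam1 * s) * (fluctuation z x s)\<^sup>2)"
  have f: "(f x has_integral lyap z x) {0..}" for x
    unfolding f_def by (rule lyap_has_integral[OF assms])
  have "((\<lambda>s. (\<Sum>i<length x. real (x ! i) * lam2 * (f (x[i := x ! i + 1]) s - f x s))
       + (\<Sum>i<length x. real (x ! i) * mu2 * (f (x[i := x ! i - 1]) s - f x s))
       + real (length x) * lam1 * (f (x @ [1]) s - f x s)) has_integral gen (lyap z) x) {0..}"
    unfolding gen_def
    by (intro has_integral_add has_integral_sum has_integral_mult_right has_integral_diff f) auto
  then show ?thesis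
    by (rule has_integral_eq[rotated])
       (simp add: gen_def f_def distrib_left sum_distrib_left right_diff_distrib mult_ac)
qed

text \<open>The drift of the integrand is at most
  \<open>e * (2 * u * u' - 2 * lam1 * u\<^sup>2 + C)\<close>. One half of the negative term
  completes \<open>2 * e * u * u'\<close> to \<open>D\<close>, the derivative of
  \<open>e * u\<^sup>2\<close>; the other half integrates to \<open>- lam1 * lyap z x\<close>. The
  integral of \<open>D\<close> is \<open>- (u 0)\<^sup>2\<close>, which is dropped at the
  end.\<close>

lemma gen_lyap_le:
  assumes z: "0 \<le> z" "z \<le> 1" and x: "x \<noteq> []"
  shows "gen (lyap z) x \<le> - lam1 * lyap z x + (lam2 + mu2 + 3 * lam1) / lam1 / real (length x)"
proof -
  \<comment> \<open>Chosen so that \<open>e s * K\<close> dominates \<open>D s\<close>: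
    \<open>lam1\<close> covers the term with \<open>u\<^sup>2\<close>, the rest covers
    \<open>2 * u * u'\<close>.\<close>
  define K where "K = lam1 + 2 * (lam1 + lam2 + mu2)"
  define C where "C = (lam2 + mu2 + 3 * lam1) / real (length x)"
  define e where "e = (\<lambda>s. exp (- lam1 * s))"
  define u where "u = fluctuation z x"
  define u' where "u' = fluctuation_deriv z x"
  define D where "D = (\<lambda>s. e s * (2 * u s * u' s) - lam1 * (e s * (u s)\<^sup>2))"
  have ee: "(e has_integral 1 / lam1) {0..}"
    using has_integral_exp_minus_to_infinity[OF lam1_pos, of 0] by (simp add: e_def)
  have u: "\<bar>u s\<bar> \<le> 1" "\<bar>u' s\<bar> \<le> lam1 + lam2 + mu2" if "s \<ge> 0" for s
    using abs_fluctuation_le[OF z that] abs_fluctuation_deriv_le[OF z that] by (auto simp: u_def u'_def)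
  have "(D has_integral 0 - e 0 * (u 0)\<^sup>2) {0..}"
  proof (rule has_integral_FTC_to_infinity)
    show "((\<lambda>s. e s * (u s)\<^sup>2) has_real_derivative D s) (at s within {0..})" if "s \<ge> 0" for s
      unfolding D_def e_def u_def u'_def
      by (auto intro!: derivative_eq_intros has_real_derivative_fluctuation z that)
    show "(\<lambda>s. e s * K) integrable_on {0..}"
      using ee by (intro integrable_on_mult_left) auto
    show "\<bar>D s\<bar> \<le> e s * K" if "s \<ge> 0" for s
    proof -
      have "(u s)\<^sup>2 \<le> 1" using u[OF that] by (simp add: abs_square_le_1)
      then have "lam1 * (u s)\<^sup>2 \<le> lam1" using lam1_pos by (simp add: mult_left_le)
      moreover have "\<bar>u s * u' s\<bar> \<le> 1 * (lam1 + lam2 + mu2)"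
        unfolding abs_mult using u[OF that] by (intro mult_mono) auto
      moreover have "lam1 * (u s)\<^sup>2 \<ge> 0" using lam1_pos by simp
      ultimately have "\<bar>2 * u s * u' s - lam1 * (u s)\<^sup>2\<bar> \<le> K" by (simp add: K_def)
      then have "e s * \<bar>2 * u s * u' s - lam1 * (u s)\<^sup>2\<bar> \<le> e s * K" by (simp add: e_def)
      moreover have "D s = e s * (2 * u s * u' s - lam1 * (u s)\<^sup>2)" by (simp add: D_def algebra_simps)
      ultimately show ?thesis by (simp add: abs_mult e_def)
    qed
    show "((\<lambda>s. e s * (u s)\<^sup>2) \<longlongrightarrow> 0) at_top"
    proof (rule Lim_null_comparison)
      show "\<forall>\<^sub>F s in at_top. norm (e s * (u s)\<^sup>2) \<le> e s"
        using eventually_ge_at_top[of 0]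
        by eventually_elim (use u in \<open>auto simp: e_def abs_mult abs_square_le_1 mult_left_le\<close>)
      show "(e \<longlongrightarrow> 0) at_top"
        unfolding e_def using lam1_pos
        by (auto intro!: filterlim_compose[OF exp_at_bot] filterlim_tendsto_pos_mult_at_top filterlim_ident
              simp: filterlim_uminus_at_bot)
    qed
  qed
  then have D: "(D has_integral - (u 0)\<^sup>2) {0..}" by (simp add: e_def)
  have R: "((\<lambda>s. D s - lam1 * (e s * (u s)\<^sup>2) + C * e s) has_integral
      - (u 0)\<^sup>2 - lam1 * lyap z x + C * (1 / lam1)) {0..}"
    using lyap_has_integral[OF z, of x] unfolding e_def[symmetric] u_def[symmetric]
    by (intro has_integral_add has_integral_diff has_integral_mult_right D ee) (simp_all add: e_def)
  have "gen (lyap z) x \<le> - (u 0)\<^sup>2 - lam1 * lyap z x + C * (1 / lam1)"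
  proof (rule has_integral_le[OF gen_lyap_has_integral[OF z] R])
    fix s :: real assume "s \<in> {0..}"
    then have s: "s \<ge> 0" by simp
    define y where "y = flow z s"
    define g where "g = resolvent lam1 (flow z) s"
    have f: "0 \<le> flow z a \<and> flow z a \<le> 1" if "a \<ge> 0" for a
      using flow_bounds[OF z that] by auto
    have "gen (\<lambda>x. (fluctuation z x s)\<^sup>2) x \<le>
      2 * (degree_pgf x y - g) *
      ((1 - y) * (mu2 - lam2 * y) * degree_pgf_deriv x y + lam1 * (y - degree_pgf x y)) + C"
      using gen_square_le[OF _ _ _ _ x, of y g] f[OF s]
        resolvent_bounds[OF lam1_pos continuous_on_flow[OF z(2)] f s]
      by (simp add: fluctuation_def y_def g_def C_def)
    \<comment> \<open>The bracket equals \<open>u' s - lam1 * u s\<close>: the equation of the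
      resolvent supplies exactly the missing terms.\<close>
    also have "\<dots> = 2 * u s * u' s - 2 * lam1 * (u s)\<^sup>2 + C"
      by (simp add: u_def u'_def fluctuation_def fluctuation_deriv_def y_def g_def algebra_simps power2_eq_square)
    finally have "e s * gen (\<lambda>x. (fluctuation z x s)\<^sup>2) x \<le> e s * (2 * u s * u' s - 2 * lam1 * (u s)\<^sup>2 + C)"
      by (simp add: e_def)
    also have "\<dots> = D s - lam1 * (e s * (u s)\<^sup>2) + C * e s"
      by (simp add: D_def algebra_simps)
    finally show "exp (- lam1 * s) * gen (\<lambda>x. (fluctuation z x s)\<^sup>2) x \<le> D s - lam1 * (e s * (u s)\<^sup>2) + C * e s"
      by (simp add: e_def)
  qed
  also have "\<dots> \<le> - lam1 * lyap z x + (lam2 + mu2 + 3 * lam1) / lam1 / real (length x)"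
    by (simp add: C_def mult_ac)
  finally show ?thesis .
qed

text \<open>The square of the fluctuation is Lipschitz in \<open>s\<close> with constant
  \<open>K\<close>, so it stays above \<open>c\<close> on \<open>{0..d}\<close>. If \<open>c\<close>
  is positive, that interval alone contributes at least \<open>d * exp (- lam1 * d) * c\<close> to
  \<open>lyap z x\<close>.\<close>

lemma fluctuation_square_le_lyap:
  assumes z: "0 \<le> z" "z \<le> 1" and d: "0 < d"
  shows "(fluctuation z x 0)\<^sup>2 \<le> 2 * (lam1 + lam2 + mu2) * d + exp (lam1 * d) / d * lyap z x"
proof -
  define K where "K = 2 * (lam1 + lam2 + mu2)"
  have K: "K \<ge> 0" using lam1_pos lam2_pos mu2_nonneg by (simp add: K_def)
  define c where "c = (fluctuation z x 0)\<^sup>2 - K * d"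
  show ?thesis
  proof (cases "c \<le> 0")
    case True
    have "0 \<le> exp (lam1 * d) / d * lyap z x"
      using lyap_nonneg[OF z] d by simp
    then show ?thesis using True unfolding c_def K_def by linarith
  next
    case False
    have low: "c \<le> (fluctuation z x s)\<^sup>2" if s: "s \<in> {0..d}" for s
    proof -
      have "norm ((fluctuation z x s)\<^sup>2 - (fluctuation z x 0)\<^sup>2) \<le> K * norm (s - 0)"
      proof (rule field_differentiable_bound[of "{0..}"])
        fix a :: real assume "a \<in> {0..}"
        then have a: "a \<ge> 0" by simp
        show "((\<lambda>s. (fluctuation z x s)\<^sup>2) has_field_derivative 2 * fluctuation z x a * fluctuation_deriv z x a)
            (at a within {0..})"
          by (auto intro!: derivative_eq_intros has_real_derivative_fluctuation z a)
        have "\<bar>fluctuation z x a * fluctuation_deriv z x a\<bar> \<le> 1 * (lam1 + lam2 + mu2)"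
          unfolding abs_mult using abs_fluctuation_le[OF z a] abs_fluctuation_deriv_le[OF z a]
          by (intro mult_mono) auto
        then show "norm (2 * fluctuation z x a * fluctuation_deriv z x a) \<le> K"
          by (simp add: K_def abs_mult)
      qed (use s in auto)
      moreover have "K * s \<le> K * d" using s K by (intro mult_left_mono) auto
      ultimately show ?thesis using s unfolding c_def by auto
    qed
    have "((\<lambda>s. exp (- lam1 * d) * c) has_integral d * (exp (- lam1 * d) * c)) {0..d}"
      using has_integral_const_real[of "exp (- lam1 * d) * c" 0 d] d by simp
    moreover have i: "(\<lambda>s. exp (- lam1 * s) * (fluctuation z x s)\<^sup>2) integrable_on {0..d}"
      using lyap_has_integral[OF z, of x] d by (auto intro: integrable_on_subinterval)
    ultimately have "d * (exp (- lam1 * d) * c) \<le> integral {0..d} (\<lambda>s. exp (- lam1 * s) * (fluctuation z x s)\<^sup>2)"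
      using low False lam1_pos
      by (intro has_integral_le[OF _ integrable_integral]) (auto intro!: mult_mono)
    also have "\<dots> \<le> lyap z x"
      unfolding lyap_def using lyap_has_integral[OF z, of x] i by (intro integral_subset_le) auto
    finally have "exp (lam1 * d) / d * (d * (exp (- lam1 * d) * c)) \<le> exp (lam1 * d) / d * lyap z x"
      using d by (intro mult_left_mono) auto
    then have "c \<le> exp (lam1 * d) / d * lyap z x"
      using d by (simp add: exp_minus field_simps)
    then show ?thesis unfolding c_def K_def by simp
  qed
qed

end

subsection \<open>One-step expectations of the chain\<close>

text \<open>A finite set outside which \<open>indeg_trans\<close> from \<open>x\<close> vanishes. A
  zero entry adds \<open>x\<close> itself as a downward target, with weight \<open>0\<close>.
  Finiteness turns all expectations below into finite sums.\<close>

definition indeg_succs :: "nat list \<Rightarrow> nat list set" where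
  "indeg_succs x = (\<lambda>i. x[i := x ! i + 1]) ` {..<length x} \<union> (\<lambda>i. x[i := x ! i - 1]) ` {..<length x} \<union> {x @ [1]}"

fun indeg_reach :: "nat \<Rightarrow> nat list set" where
  "indeg_reach 0 = {[1]}"
| "indeg_reach (Suc t) = (\<Union>x\<in>indeg_reach t. indeg_succs x)"

lemma finite_indeg_succs [simp]: "finite (indeg_succs x)"
  by (simp add: indeg_succs_def)

lemma finite_indeg_reach [simp]: "finite (indeg_reach t)"
  by (induction t) auto

lemma indeg_succs_size:
  assumes "y \<in> indeg_succs x"
  shows "length x \<le> length y" "length y \<le> Suc (length x)" "sum_list y \<le> Suc (sum_list x)"
  using assms elem_le_sum_list
  by (auto simp: indeg_succs_def sum_list_update)

lemma indeg_reach_size: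
  assumes "x \<in> indeg_reach t"
  shows "x \<noteq> [] \<and> length x \<le> Suc t \<and> sum_list x \<le> Suc t"
  using assms
proof (induction t arbitrary: x)
  case (Suc t)
  then obtain w where w: "w \<in> indeg_reach t" "x \<in> indeg_succs w" by auto
  show ?case using Suc.IH[OF w(1)] indeg_succs_size[OF w(2)] by auto
qed auto

context indegree_params
begin

lemma rate_pos: "x \<noteq> [] \<Longrightarrow> rate x > 0"
  using lam1_pos lam2_pos mu2_nonneg by (auto simp: indeg_total_rate_def intro!: add_nonneg_pos)

text \<open>The transition weights are the rates of \<open>gen\<close> divided by
  \<open>rate x\<close>, and the rates add up to \<open>rate x\<close>. Summing point masses over
  \<open>S\<close> needs only that all targets lie in \<open>S\<close>.\<close>

lemma sum_indeg_trans:
  assumes S: "finite S" "indeg_succs x \<subseteq> S" and x: "x \<noteq> []"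
  shows "(\<Sum>y\<in>S. indeg_trans lam1 lam2 mu2 x y * f y) = f x + gen f x / rate x"
proof -
  let ?r = "rate x"
  have del: "(\<Sum>y\<in>S. (\<Sum>i<length x. if y = g i then w i else 0) * f y) = (\<Sum>i<length x. w i * f (g i))"
    if "\<And>i. i < length x \<Longrightarrow> g i \<in> S" for g and w :: "nat \<Rightarrow> real"
  proof -
    have "(\<Sum>y\<in>S. (\<Sum>i<length x. if y = g i then w i else 0) * f y)
        = (\<Sum>i<length x. \<Sum>y\<in>S. if y = g i then w i * f y else 0)"
      by (subst sum.swap) (auto simp: sum_distrib_right intro!: sum.cong)
    also have "\<dots> = (\<Sum>i<length x. w i * f (g i))"
      using that S by (intro sum.cong) auto
    finally show ?thesis .
  qed
  have "(\<Sum>y\<in>S. indeg_trans lam1 lam2 mu2 x y * f y)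
      = (\<Sum>i<length x. real (x ! i) * lam2 / ?r * f (x[i := x ! i + 1]))
      + (\<Sum>i<length x. real (x ! i) * mu2 / ?r * f (x[i := x ! i - 1]))
      + real (length x) * lam1 / ?r * f (x @ [1])"
    unfolding indeg_trans_def distrib_right sum.distrib
    using S by (subst (1 2) del) (auto simp: indeg_succs_def if_distrib[of "\<lambda>u. u * _"] cong: if_cong)
  also have "\<dots> = f x + gen f x / ?r"
  proof -
    have r: "(\<Sum>i<length x. real (x ! i)) = real (sum_list x)"
      by (simp add: sum_list_sum_nth lessThan_atLeast0)
    have "gen f x = (\<Sum>i<length x. real (x ! i) * lam2 * f (x[i := x ! i + 1]))
      + (\<Sum>i<length x. real (x ! i) * mu2 * f (x[i := x ! i - 1]))
      + real (length x) * lam1 * f (x @ [1])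
      - ((\<Sum>i<length x. real (x ! i)) * lam2 + (\<Sum>i<length x. real (x ! i)) * mu2 + real (length x) * lam1) * f x"
      unfolding gen_def right_diff_distrib sum_subtractf distrib_right sum_distrib_right by simp
    also have "(\<Sum>i<length x. real (x ! i)) * lam2 + (\<Sum>i<length x. real (x ! i)) * mu2 + real (length x) * lam1 = ?r"
      unfolding r indeg_total_rate_def by (simp add: algebra_simps)
    finally have "gen f x = (\<Sum>i<length x. real (x ! i) * lam2 * f (x[i := x ! i + 1]))
      + (\<Sum>i<length x. real (x ! i) * mu2 * f (x[i := x ! i - 1]))
      + real (length x) * lam1 * f (x @ [1]) - ?r * f x" .
    then show ?thesis
      using rate_pos[OF x] by (simp add: add_divide_distrib diff_divide_distrib sum_divide_distrib)
  qed
  finally show ?thesis .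
qed

end

section \<open>Markov property and expectations along the chain\<close>

locale indegree_process = indegree_params lam1 lam2 mu2
  for lam1 lam2 mu2 :: real +
  fixes M :: "'a measure" and d :: "nat \<Rightarrow> 'a \<Rightarrow> nat list"
  assumes chain: "indegree_chain M lam1 lam2 mu2 d"
begin

sublocale prob_space M
  using chain unfolding indegree_chain_def by blast

abbreviation trans_prob :: "nat list \<Rightarrow> nat list \<Rightarrow> real" where
  "trans_prob \<equiv> indeg_trans lam1 lam2 mu2"

lemma measurable_d: "d t \<in> measurable M (count_space indeg_states)"
  using chain unfolding indegree_chain_def by blast

lemma measurable_d_UNIV [measurable]: "d t \<in> measurable M (count_space UNIV)"
  by (rule measurable_compose[OF measurable_d, of "\<lambda>x. x"]) auto

lemma measurable_history [measurable]: "{\<omega> \<in> space M. \<forall>s\<le>t. d s \<omega> = h s} \<in> events"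
  by measurable

text \<open>The Markov property in product form. It extends to histories of probability zero, about
  which the conditional form says nothing, because both sides then vanish.\<close>

lemma prob_history_step:
  assumes "y \<in> indeg_states"
  shows "\<P>(\<omega> in M. d (Suc t) \<omega> = y \<and> (\<forall>s\<le>t. d s \<omega> = h s)) = \<P>(\<omega> in M. \<forall>s\<le>t. d s \<omega> = h s) * trans_prob (h t) y"
proof (cases "\<P>(\<omega> in M. \<forall>s\<le>t. d s \<omega> = h s) > 0")
  case True
  then have "\<P>(\<omega> in M. d (Suc t) \<omega> = y \<bar> \<forall>s\<le>t. d s \<omega> = h s) = trans_prob (h t) y"
    using chain assms unfolding indegree_chain_def by blast
  then show ?thesis
    using True unfolding cond_prob_def by (simp add: divide_eq_eq mult.commute split: if_splits)
next
  case False
  then have 0: "\<P>(\<omega> in M. \<forall>s\<le>t. d s \<omega> = h s) = 0" by (simp add: zero_less_measure_iff)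
  have "\<P>(\<omega> in M. d (Suc t) \<omega> = y \<and> (\<forall>s\<le>t. d s \<omega> = h s)) \<le> \<P>(\<omega> in M. \<forall>s\<le>t. d s \<omega> = h s)"
    by (intro finite_measure_mono) auto
  then show ?thesis using 0 by (simp add: measure_le_0_iff)
qed

text \<open>Almost every outcome follows exactly one of finitely many histories. Taking them from
  \<open>PiE\<close>, hence fixed outside \<open>{..t}\<close>, makes their set finite and ensures
  that distinct histories differ at some time up to \<open>t\<close>.\<close>

lemma prob_sum_histories:
  assumes H: "AE \<omega> in M. \<forall>s\<le>t. d s \<omega> \<in> R s" "\<And>s. finite (R s)"
    and A: "{\<omega> \<in> space M. A \<omega>} \<in> events"
  shows "\<P>(\<omega> in M. A \<omega>) = (\<Sum>h\<in>PiE {..t} R. \<P>(\<omega> in M. A \<omega> \<and> (\<forall>s\<le>t. d s \<omega> = h s)))"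
proof -
  have m: "{\<omega> \<in> space M. A \<omega> \<and> (\<forall>s\<le>t. d s \<omega> = h s)} \<in> events" for h
    by (intro sets.sets_Collect_conj A measurable_history)
  have fin: "finite (PiE {..t} R)" using H by (intro finite_PiE) auto
  have "\<P>(\<omega> in M. A \<omega>) = prob (\<Union>h\<in>PiE {..t} R. {\<omega> \<in> space M. A \<omega> \<and> (\<forall>s\<le>t. d s \<omega> = h s)})"
  proof (rule finite_measure_eq_AE)
    show "AE \<omega> in M. \<omega> \<in> {\<omega> \<in> space M. A \<omega>} \<longleftrightarrow>
        \<omega> \<in> (\<Union>h\<in>PiE {..t} R. {\<omega> \<in> space M. A \<omega> \<and> (\<forall>s\<le>t. d s \<omega> = h s)})"
      using H(1)
    proof eventually_elim
      fix \<omega> assume r: "\<forall>s\<le>t. d s \<omega> \<in> R s"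
      show "\<omega> \<in> {\<omega> \<in> space M. A \<omega>} \<longleftrightarrow>
        \<omega> \<in> (\<Union>h\<in>PiE {..t} R. {\<omega> \<in> space M. A \<omega> \<and> (\<forall>s\<le>t. d s \<omega> = h s)})"
        using r by (auto intro!: bexI[of _ "restrict (\<lambda>s. d s \<omega>) {..t}"] split: if_splits)
    qed
  qed (use A m fin in auto)
  also have "\<dots> = (\<Sum>h\<in>PiE {..t} R. \<P>(\<omega> in M. A \<omega> \<and> (\<forall>s\<le>t. d s \<omega> = h s)))"
  proof (rule finite_measure_finite_Union[OF fin])
    show "disjoint_family_on (\<lambda>h. {\<omega> \<in> space M. A \<omega> \<and> (\<forall>s\<le>t. d s \<omega> = h s)}) (PiE {..t} R)"
      unfolding disjoint_family_on_def
    proof (intro ballI impI)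
      fix h k assume hk: "h \<in> PiE {..t} R" "k \<in> PiE {..t} R" "h \<noteq> k"
      then obtain s where "s \<le> t" "h s \<noteq> k s" using PiE_ext[OF hk(1,2)] by auto
      then show "{\<omega> \<in> space M. A \<omega> \<and> (\<forall>s\<le>t. d s \<omega> = h s)} \<inter> {\<omega> \<in> space M. A \<omega> \<and> (\<forall>s\<le>t. d s \<omega> = k s)} = {}"
        by auto
    qed
  qed (use m in auto)
  finally show ?thesis .
qed

text \<open>Summing \<open>prob_history_step\<close> over all histories that end in \<open>x\<close>
  forgets the past. \<open>H\<close> is an assumption because this lemma serves in the induction
  that establishes it.\<close>

lemma prob_step:
  assumes H: "AE \<omega> in M. \<forall>s\<le>t. d s \<omega> \<in> indeg_reach s" and y: "y \<in> indeg_states"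
  shows "\<P>(\<omega> in M. d t \<omega> = x \<and> d (Suc t) \<omega> = y) = \<P>(\<omega> in M. d t \<omega> = x) * trans_prob x y"
proof -
  have e: "\<P>(\<omega> in M. (d t \<omega> = x \<and> d (Suc t) \<omega> = y) \<and> (\<forall>s\<le>t. d s \<omega> = h s))
      = \<P>(\<omega> in M. d t \<omega> = x \<and> (\<forall>s\<le>t. d s \<omega> = h s)) * trans_prob x y" for h
  proof (cases "h t = x")
    case True
    then have "(d t \<omega> = x \<and> d (Suc t) \<omega> = y) \<and> (\<forall>s\<le>t. d s \<omega> = h s) \<longleftrightarrow> d (Suc t) \<omega> = y \<and> (\<forall>s\<le>t. d s \<omega> = h s)"
      "d t \<omega> = x \<and> (\<forall>s\<le>t. d s \<omega> = h s) \<longleftrightarrow> (\<forall>s\<le>t. d s \<omega> = h s)" for \<omega> by auto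
    then show ?thesis using prob_history_step[OF y, of t h] True by simp
  next
    case False
    then have "{\<omega> \<in> space M. (d t \<omega> = x \<and> d (Suc t) \<omega> = y) \<and> (\<forall>s\<le>t. d s \<omega> = h s)} = {}"
      "{\<omega> \<in> space M. d t \<omega> = x \<and> (\<forall>s\<le>t. d s \<omega> = h s)} = {}" by auto
    then show ?thesis by (simp only: measure_empty mult_zero_left)
  qed
  have "\<P>(\<omega> in M. d t \<omega> = x \<and> d (Suc t) \<omega> = y)
      = (\<Sum>h\<in>PiE {..t} indeg_reach. \<P>(\<omega> in M. (d t \<omega> = x \<and> d (Suc t) \<omega> = y) \<and> (\<forall>s\<le>t. d s \<omega> = h s)))"
    by (rule prob_sum_histories[OF H]) auto
  also have "\<dots> = (\<Sum>h\<in>PiE {..t} indeg_reach. \<P>(\<omega> in M. d t \<omega> = x \<and> (\<forall>s\<le>t. d s \<omega> = h s))) * trans_prob x y"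
    unfolding e sum_distrib_right ..
  also have "(\<Sum>h\<in>PiE {..t} indeg_reach. \<P>(\<omega> in M. d t \<omega> = x \<and> (\<forall>s\<le>t. d s \<omega> = h s))) = \<P>(\<omega> in M. d t \<omega> = x)"
    by (rule prob_sum_histories[OF H, symmetric]) auto
  finally show ?thesis .
qed

lemma prob_finite_range:
  assumes "finite S" and A: "{\<omega> \<in> space M. A \<omega>} \<in> events" and X [measurable]: "X \<in> measurable M (count_space UNIV)"
  shows "\<P>(\<omega> in M. A \<omega> \<and> X \<omega> \<in> S) = (\<Sum>x\<in>S. \<P>(\<omega> in M. A \<omega> \<and> X \<omega> = x))"
proof -
  have m: "{\<omega> \<in> space M. A \<omega> \<and> X \<omega> = x} \<in> events" for x
    using A by measurable
  have "{\<omega> \<in> space M. A \<omega> \<and> X \<omega> \<in> S} = (\<Union>x\<in>S. {\<omega> \<in> space M. A \<omega> \<and> X \<omega> = x})" by auto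
  then show ?thesis
    using finite_measure_finite_Union[OF assms(1), of "\<lambda>x. {\<omega> \<in> space M. A \<omega> \<and> X \<omega> = x}"] m
    by (auto simp: disjoint_family_on_def)
qed

text \<open>The transition weights into \<open>indeg_reach (Suc t)\<close> sum to \<open>1\<close>,
  as \<open>gen\<close> annihilates constants, so the mass carried by \<open>indeg_reach t\<close>
  passes completely to the next set.\<close>

lemma AE_indeg_reach: "AE \<omega> in M. \<forall>s\<le>t. d s \<omega> \<in> indeg_reach s"
proof (induction t)
  case 0
  have "AE \<omega> in M. d 0 \<omega> = [1]" using chain unfolding indegree_chain_def by blast
  then show ?case by simp
next
  case (Suc t)
  let ?R = "indeg_reach (Suc t)"
  have st: "x \<in> indeg_states" if "x \<in> ?R" for x
    using indeg_reach_size[OF that] by (auto simp: indeg_states_def)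
  have "(\<Sum>x\<in>indeg_reach t. \<P>(\<omega> in M. d t \<omega> = x)) = \<P>(\<omega> in M. d t \<omega> \<in> indeg_reach t)"
    using prob_finite_range[of "indeg_reach t" "\<lambda>_. True" "d t"] by simp
  also have "\<dots> = 1"
    using Suc by (intro prob_Collect_eq_1[THEN iffD2]) auto
  finally have 1: "(\<Sum>x\<in>indeg_reach t. \<P>(\<omega> in M. d t \<omega> = x)) = 1" .
  have "\<P>(\<omega> in M. d (Suc t) \<omega> \<in> ?R) \<ge> \<P>(\<omega> in M. d (Suc t) \<omega> \<in> ?R \<and> d t \<omega> \<in> indeg_reach t)"
    by (intro finite_measure_mono) auto
  also have "\<P>(\<omega> in M. d (Suc t) \<omega> \<in> ?R \<and> d t \<omega> \<in> indeg_reach t)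
      = (\<Sum>x\<in>indeg_reach t. \<P>(\<omega> in M. d (Suc t) \<omega> \<in> ?R \<and> d t \<omega> = x))"
    by (intro prob_finite_range) auto
  also have "\<dots> = (\<Sum>x\<in>indeg_reach t. \<Sum>y\<in>?R. \<P>(\<omega> in M. d t \<omega> = x \<and> d (Suc t) \<omega> = y))"
    by (subst conj_commute, intro sum.cong refl prob_finite_range) auto
  also have "\<dots> = (\<Sum>x\<in>indeg_reach t. \<P>(\<omega> in M. d t \<omega> = x) * (\<Sum>y\<in>?R. trans_prob x y * 1))"
    unfolding sum_distrib_left by (intro sum.cong refl) (simp add: prob_step[OF Suc] st del: indeg_reach.simps)
  also have "\<dots> = (\<Sum>x\<in>indeg_reach t. \<P>(\<omega> in M. d t \<omega> = x))"
  proof (intro sum.cong refl)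
    fix x assume x: "x \<in> indeg_reach t"
    have "(\<Sum>y\<in>?R. trans_prob x y * 1) = 1 + gen (\<lambda>_. 1) x / rate x"
      using x indeg_reach_size[OF x] by (intro sum_indeg_trans) auto
    then show "\<P>(\<omega> in M. d t \<omega> = x) * (\<Sum>y\<in>?R. trans_prob x y * 1) = \<P>(\<omega> in M. d t \<omega> = x)"
      by (simp add: gen_def)
  qed
  finally have "\<P>(\<omega> in M. d (Suc t) \<omega> \<in> ?R) = 1"
    using 1 prob_le_1 by (intro antisym) auto
  then have "AE \<omega> in M. d (Suc t) \<omega> \<in> ?R"
    by (subst (asm) prob_Collect_eq_1) auto
  with Suc show ?case
    by eventually_elim (auto simp: le_Suc_eq)
qed

text \<open>Expectation of \<open>f (d t)\<close>, a finite sum because \<open>d t\<close> almost surely lies in \<open>indeg_reach t\<close>.\<close>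

definition mean :: "nat \<Rightarrow> (nat list \<Rightarrow> real) \<Rightarrow> real" where
  "mean t f = (\<Sum>x\<in>indeg_reach t. \<P>(\<omega> in M. d t \<omega> = x) * f x)"

lemma prob_eq_sum_reach:
  assumes "{\<omega> \<in> space M. A \<omega>} \<in> events"
  shows "\<P>(\<omega> in M. A \<omega>) = (\<Sum>x\<in>indeg_reach t. \<P>(\<omega> in M. A \<omega> \<and> d t \<omega> = x))"
proof -
  have "\<P>(\<omega> in M. A \<omega>) = \<P>(\<omega> in M. A \<omega> \<and> d t \<omega> \<in> indeg_reach t)"
    using AE_indeg_reach[of t] by (intro finite_measure_eq_AE sets.sets_Collect_conj assms) auto
  then show ?thesis using assms by (simp add: prob_finite_range)
qed

lemma mean_const: "mean t (\<lambda>_. c) = c"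
  using prob_eq_sum_reach[of "\<lambda>_. True" t] prob_space
  by (simp add: mean_def flip: sum_distrib_right)

lemma mean_add: "mean t (\<lambda>x. f x + g x) = mean t f + mean t g"
  by (simp add: mean_def distrib_left sum.distrib)

lemma mean_diff: "mean t (\<lambda>x. f x - g x) = mean t f - mean t g"
  by (simp add: mean_def right_diff_distrib sum_subtractf)

lemma mean_cmult: "mean t (\<lambda>x. c * f x) = c * mean t f"
  by (simp add: mean_def sum_distrib_left mult_ac)

lemma mean_mono: "(\<And>x. x \<in> indeg_reach t \<Longrightarrow> f x \<le> g x) \<Longrightarrow> mean t f \<le> mean t g"
  unfolding mean_def by (intro sum_mono mult_left_mono) auto

lemma mean_nonneg: "(\<And>x. x \<in> indeg_reach t \<Longrightarrow> 0 \<le> f x) \<Longrightarrow> 0 \<le> mean t f"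
  unfolding mean_def by (intro sum_nonneg mult_nonneg_nonneg) auto

lemma mean_Suc: "mean (Suc t) f = mean t (\<lambda>x. f x + gen f x / rate x)"
proof -
  let ?R = "indeg_reach (Suc t)"
  have st: "x \<in> indeg_states" if "x \<in> ?R" for x
    using indeg_reach_size[OF that] by (auto simp: indeg_states_def)
  have "\<P>(\<omega> in M. d (Suc t) \<omega> = y) = (\<Sum>x\<in>indeg_reach t. \<P>(\<omega> in M. d t \<omega> = x) * trans_prob x y)"
    if "y \<in> ?R" for y
    using prob_eq_sum_reach[of "\<lambda>\<omega>. d (Suc t) \<omega> = y" t] prob_step[OF AE_indeg_reach st[OF that]]
    by (simp add: conj_commute del: indeg_reach.simps)
  then have "mean (Suc t) f = (\<Sum>y\<in>?R. \<Sum>x\<in>indeg_reach t. \<P>(\<omega> in M. d t \<omega> = x) * (trans_prob x y * f y))"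
    by (simp add: mean_def sum_distrib_right mult.assoc del: indeg_reach.simps)
  also have "\<dots> = (\<Sum>x\<in>indeg_reach t. \<P>(\<omega> in M. d t \<omega> = x) * (\<Sum>y\<in>?R. trans_prob x y * f y))"
    by (subst sum.swap) (simp only: sum_distrib_left)
  also have "\<dots> = mean t (\<lambda>x. f x + gen f x / rate x)"
    unfolding mean_def
  proof (intro sum.cong refl arg_cong2[where f = "(*)"] sum_indeg_trans)
    fix x assume x: "x \<in> indeg_reach t"
    show "x \<noteq> []" using indeg_reach_size[OF x] by auto
    show "indeg_succs x \<subseteq> ?R" using x by auto
  qed simp
  finally show ?thesis .
qed

text \<open>Split by the number of vertices \<open>n\<close>, insert the prescribed conditional law,
  split further by the state, and regroup the states by length. For fixed \<open>x\<close> the sum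
  over \<open>i\<close> counts the vertices of in-degree \<open>j\<close>.\<close>

lemma prob_uniform_vertex_indegree:
  assumes u: "uniform_vertex_indegree M (d t) V"
  shows "\<P>(\<omega> in M. V \<omega> = j) = mean t (\<lambda>x. real (card {i. i < length x \<and> x ! i = j}) / real (length x))"
proof -
  have [measurable]: "V \<in> measurable M (count_space UNIV)"
    using u by (simp add: uniform_vertex_indegree_def)
  define N where "N = length ` indeg_reach t"
  have N: "finite N" "\<And>n. n \<in> N \<Longrightarrow> n \<ge> 1"
    using indeg_reach_size by (force simp: N_def Suc_le_eq)+
  have *: "\<P>(\<omega> in M. V \<omega> = j \<and> length (d t \<omega>) = n)
      = (\<Sum>i<n. \<P>(\<omega> in M. d t \<omega> ! i = j \<and> length (d t \<omega>) = n)) / real n" if n: "n \<ge> 1" for n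
  proof (cases "\<P>(\<omega> in M. length (d t \<omega>) = n) > 0")
    case True
    then have "\<P>(\<omega> in M. V \<omega> = j \<bar> length (d t \<omega>) = n) =
          1 / real n * (\<Sum>i<n. \<P>(\<omega> in M. d t \<omega> ! i = j \<bar> length (d t \<omega>) = n))"
      using u n by (simp add: uniform_vertex_indegree_def)
    then show ?thesis
      using True unfolding cond_prob_def by (simp add: field_simps flip: sum_divide_distrib)
  next
    case False
    then have 0: "\<P>(\<omega> in M. length (d t \<omega>) = n) = 0" by (simp add: zero_less_measure_iff)
    \<comment> \<open>Lengths of probability zero contribute nothing on either side.
      \<open>P\<close> is arbitrary, so the set may fail to be an event; its measure is then
      \<open>0\<close> by default.\<close>
    have "\<P>(\<omega> in M. P \<omega> \<and> length (d t \<omega>) = n) = 0" for P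
    proof (cases "{\<omega> \<in> space M. P \<omega> \<and> length (d t \<omega>) = n} \<in> events")
      case True
      have "\<P>(\<omega> in M. P \<omega> \<and> length (d t \<omega>) = n) \<le> \<P>(\<omega> in M. length (d t \<omega>) = n)"
        by (intro finite_measure_mono) auto
      then show ?thesis using 0 by (simp add: measure_le_0_iff)
    qed (simp add: measure_notin_sets)
    then show ?thesis by simp
  qed
  have "\<P>(\<omega> in M. V \<omega> = j) = \<P>(\<omega> in M. V \<omega> = j \<and> length (d t \<omega>) \<in> N)"
    using AE_indeg_reach[of t] by (intro finite_measure_eq_AE) (auto simp: N_def)
  also have "\<dots> = (\<Sum>n\<in>N. \<P>(\<omega> in M. V \<omega> = j \<and> length (d t \<omega>) = n))"
    using prob_finite_range[OF N(1), of "\<lambda>\<omega>. V \<omega> = j" "\<lambda>\<omega>. length (d t \<omega>)"] by simp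
  also have "\<dots> = (\<Sum>n\<in>N. \<Sum>i<n. \<P>(\<omega> in M. d t \<omega> ! i = j \<and> length (d t \<omega>) = n) / real n)"
    using N by (intro sum.cong) (auto simp: * sum_divide_distrib)
  also have "\<dots> = (\<Sum>n\<in>N. \<Sum>x\<in>{x \<in> indeg_reach t. length x = n}.
      \<P>(\<omega> in M. d t \<omega> = x) * (real (card {i. i < length x \<and> x ! i = j}) / real (length x)))"
  proof (intro sum.cong refl)
    fix n assume "n \<in> N"
    have "(\<Sum>i<n. \<P>(\<omega> in M. d t \<omega> ! i = j \<and> length (d t \<omega>) = n) / real n)
        = (\<Sum>i<n. \<Sum>x\<in>indeg_reach t. if length x = n \<and> x ! i = j then \<P>(\<omega> in M. d t \<omega> = x) / real n else 0)"
    proof (intro sum.cong refl)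
      fix i
      have "\<P>(\<omega> in M. d t \<omega> ! i = j \<and> length (d t \<omega>) = n)
          = (\<Sum>x\<in>indeg_reach t. \<P>(\<omega> in M. (d t \<omega> ! i = j \<and> length (d t \<omega>) = n) \<and> d t \<omega> = x))"
        by (rule prob_eq_sum_reach) measurable
      also have "\<dots> = (\<Sum>x\<in>indeg_reach t. if length x = n \<and> x ! i = j then \<P>(\<omega> in M. d t \<omega> = x) else 0)"
      proof (intro sum.cong refl)
        fix x
        have "{\<omega> \<in> space M. (d t \<omega> ! i = j \<and> length (d t \<omega>) = n) \<and> d t \<omega> = x}
          = (if length x = n \<and> x ! i = j then {\<omega> \<in> space M. d t \<omega> = x} else {})" by auto
        then show "\<P>(\<omega> in M. (d t \<omega> ! i = j \<and> length (d t \<omega>) = n) \<and> d t \<omega> = x)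
          = (if length x = n \<and> x ! i = j then \<P>(\<omega> in M. d t \<omega> = x) else 0)" by simp
      qed
      finally show "\<P>(\<omega> in M. d t \<omega> ! i = j \<and> length (d t \<omega>) = n) / real n
        = (\<Sum>x\<in>indeg_reach t. if length x = n \<and> x ! i = j then \<P>(\<omega> in M. d t \<omega> = x) / real n else 0)"
        by (simp add: sum_divide_distrib if_distrib[of "\<lambda>u. u / real n"] cong: if_cong)
    qed
    also have "\<dots> = (\<Sum>x\<in>indeg_reach t. \<Sum>i<n. if length x = n \<and> x ! i = j then \<P>(\<omega> in M. d t \<omega> = x) / real n else 0)"
      by (rule sum.swap)
    also have "\<dots> = (\<Sum>x\<in>indeg_reach t. if length x = n then
        \<P>(\<omega> in M. d t \<omega> = x) * (real (card {i. i < length x \<and> x ! i = j}) / real (length x)) else 0)"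
    proof (intro sum.cong refl)
      fix x
      have "(\<Sum>i<length x. if x ! i = j then c else 0) = real (card {i. i < length x \<and> x ! i = j}) * c" for c :: real
        using sum.inter_filter[of "{..<length x}" "\<lambda>_. c" "\<lambda>i. x ! i = j"] by simp
      then show "(\<Sum>i<n. if length x = n \<and> x ! i = j then \<P>(\<omega> in M. d t \<omega> = x) / real n else 0)
        = (if length x = n then
        \<P>(\<omega> in M. d t \<omega> = x) * (real (card {i. i < length x \<and> x ! i = j}) / real (length x)) else 0)"
        by (cases "length x = n") simp_all
    qed
    also have "\<dots> = (\<Sum>x\<in>{x \<in> indeg_reach t. length x = n}.
      \<P>(\<omega> in M. d t \<omega> = x) * (real (card {i. i < length x \<and> x ! i = j}) / real (length x)))"
      by (rule sum.inter_filter[symmetric]) simp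
    finally show "(\<Sum>i<n. \<P>(\<omega> in M. d t \<omega> ! i = j \<and> length (d t \<omega>) = n) / real n) = \<dots>" .
  qed
  also have "\<dots> = mean t (\<lambda>x. real (card {i. i < length x \<and> x ! i = j}) / real (length x))"
    unfolding mean_def using N by (intro sum.group) (auto simp: N_def)
  finally show ?thesis .
qed

lemma mean_degree_pgf:
  assumes u: "uniform_vertex_indegree M (d t) V"
  shows "(\<lambda>j. \<P>(\<omega> in M. V \<omega> = j) * z ^ j) sums mean t (\<lambda>x. degree_pgf x z)"
proof -
  have s: "(\<lambda>j. real (card {i. i < length x \<and> x ! i = j}) / real (length x) * z ^ j) sums degree_pgf x z" for x
  proof -
    have "(\<lambda>j. real (card {i. i < length x \<and> x ! i = j}) / real (length x) * z ^ j) sums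
      (\<Sum>j\<in>set x. real (card {i. i < length x \<and> x ! i = j}) / real (length x) * z ^ j)"
    proof (rule sums_finite)
      fix j assume "j \<notin> set x"
      then have "{i. i < length x \<and> x ! i = j} = {}" by auto
      then show "real (card {i. i < length x \<and> x ! i = j}) / real (length x) * z ^ j = 0"
        by (simp only: card.empty)
    qed simp
    also have "(\<Sum>j\<in>set x. real (card {i. i < length x \<and> x ! i = j}) / real (length x) * z ^ j)
      = (\<Sum>j\<in>set x. \<Sum>i\<in>{i \<in> {..<length x}. x ! i = j}. z ^ (x ! i) / real (length x))"
      by (intro sum.cong) auto
    also have "\<dots> = (\<Sum>i<length x. z ^ (x ! i) / real (length x))"
      by (intro sum.group) auto
    finally show ?thesis by (simp add: degree_pgf_def sum_divide_distrib)
  qed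
  have "(\<lambda>j. \<Sum>x\<in>indeg_reach t. \<P>(\<omega> in M. d t \<omega> = x) * (real (card {i. i < length x \<and> x ! i = j}) / real (length x) * z ^ j))
      sums mean t (\<lambda>x. degree_pgf x z)"
    unfolding mean_def by (intro sums_sum sums_mult s)
  then show ?thesis
    by (simp add: prob_uniform_vertex_indegree[OF u] mean_def sum_distrib_right mult.assoc)
qed

end

subsection \<open>Convergence\<close>

text \<open>The combination \<open>v\<close> of \<open>a\<close> and \<open>b\<close> decreases and
  is nonnegative, so it converges, and with \<open>b\<close> also \<open>a\<close>. A positive limit
  of \<open>a\<close> would make the decrements of \<open>v\<close> eventually dominate a multiple
  of the harmonic series, while they telescope to a finite sum.\<close>

lemma tendsto_zero_of_harmonic_drift:
  fixes a b :: "nat \<Rightarrow> real"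
  assumes a: "\<And>t. a t \<ge> 0" and b: "\<And>t. b t \<ge> 0" "decseq b" and k: "k > 0" and c: "c \<ge> 0"
    and step: "\<And>t. a (Suc t) + c * b (Suc t) \<le> a t + c * b t - k * a t / real (Suc t)"
  shows "a \<longlonglongrightarrow> 0"
proof -
  define v where "v = (\<lambda>t. a t + c * b t)"
  have vs: "k * a t / real (Suc t) \<le> v t - v (Suc t)" for t
    using step[of t] by (simp add: v_def)
  have "v (Suc t) \<le> v t" for t
  proof -
    have "0 \<le> k * a t / real (Suc t)" using a k by simp
    then show ?thesis using vs[of t] by linarith
  qed
  then have "decseq v" by (rule decseq_SucI)
  moreover have "0 \<le> v t" for t using a b c by (simp add: v_def)
  ultimately obtain V where V: "v \<longlonglongrightarrow> V" using decseq_convergent[of v 0] by blast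
  obtain B where B: "b \<longlonglongrightarrow> B" using decseq_convergent[of b 0] b by blast
  have "(\<lambda>t. v t - c * b t) \<longlonglongrightarrow> V - c * B" by (intro tendsto_intros V B)
  define A where "A = V - c * B"
  then have A: "a \<longlonglongrightarrow> A" using \<open>(\<lambda>t. v t - c * b t) \<longlonglongrightarrow> V - c * B\<close> by (simp add: v_def)
  have A0: "A \<ge> 0" using a by (intro LIMSEQ_le_const[OF A]) auto
  have "A = 0"
  proof (rule ccontr)
    assume "A \<noteq> 0"
    then have pos: "A > 0" using A0 by simp
    then have ev: "\<forall>\<^sub>F t in sequentially. a t > A / 2"
      using order_tendstoD(1)[OF A, of "A / 2"] by simp
    have "summable (\<lambda>t. v t - v (Suc t))" using telescope_summable'[OF V] .
    moreover have "\<forall>\<^sub>F t in sequentially. norm (k * (A / 2) * inverse (real (Suc t))) \<le> v t - v (Suc t)"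
      using ev
    proof eventually_elim
      fix t assume "a t > A / 2"
      then have "k * (A / 2) / real (Suc t) \<le> k * a t / real (Suc t)"
        using k by (intro divide_right_mono mult_left_mono) simp_all
      moreover have "norm (k * (A / 2) * inverse (real (Suc t))) = k * (A / 2) / real (Suc t)"
      proof -
        have "0 \<le> k * (A / 2) * inverse (real (Suc t))"
          using k pos by (intro mult_nonneg_nonneg) auto
        then show ?thesis by (simp only: real_norm_def abs_of_nonneg divide_inverse)
      qed
      ultimately show "norm (k * (A / 2) * inverse (real (Suc t))) \<le> v t - v (Suc t)"
        using vs[of t] by linarith
    qed
    ultimately have "summable (\<lambda>t. k * (A / 2) * inverse (real (Suc t)))"
      by (rule summable_comparison_test_ev[rotated])
    then have "summable (\<lambda>t. inverse (real (Suc t)))"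
      by (rule summable_mult_D) (use k pos in simp)
    then show False
      using not_summable_harmonic[where ?'a = real] summable_Suc_iff[of "\<lambda>t. inverse (real t)"] by blast
  qed
  then show ?thesis using A by simp
qed

context indegree_process
begin

lemma rate_le:
  assumes "x \<in> indeg_reach t"
  shows "rate x \<le> (lam1 + lam2 + mu2) * real (Suc t)"
proof -
  have "length x \<le> Suc t" "sum_list x \<le> Suc t" using indeg_reach_size[OF assms] by auto
  then have "real (length x) \<le> real (Suc t)" "real (sum_list x) \<le> real (Suc t)" by linarith+
  then have "(lam2 + mu2) * real (sum_list x) + lam1 * real (length x)
      \<le> (lam2 + mu2) * real (Suc t) + lam1 * real (Suc t)"
    using lam1_pos lam2_pos mu2_nonneg by (intro add_mono mult_left_mono) auto
  then show ?thesis unfolding indeg_total_rate_def by (simp add: algebra_simps)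
qed

lemma mean_lyap_tendsto_0:
  assumes z: "0 \<le> z" "z \<le> 1"
  shows "(\<lambda>t. mean t (lyap z)) \<longlonglongrightarrow> 0"
proof -
  define C where "C = (lam2 + mu2 + 3 * lam1) / lam1"
  define K where "K = lam1 + lam2 + mu2"
  have C: "C \<ge> 0" and K: "K > 0" using lam1_pos lam2_pos mu2_nonneg by (auto simp: C_def K_def)
  define b where "b = (\<lambda>t. mean t (\<lambda>x. 1 / real (length x)))"
  have b_Suc: "b (Suc t) = mean t (\<lambda>x. 1 / real (length x) + gen (\<lambda>x. 1 / real (length x)) x / rate x)" for t
    unfolding b_def by (rule mean_Suc)
  have dec: "b (Suc t) \<le> b t" for t
    unfolding b_Suc unfolding b_def
  proof (rule mean_mono)
    fix x assume "x \<in> indeg_reach t"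
    then have x: "x \<noteq> []" using indeg_reach_size by blast
    show "1 / real (length x) + gen (\<lambda>x. 1 / real (length x)) x / rate x \<le> 1 / real (length x)"
      unfolding gen_inverse_length[OF x] using rate_pos[OF x] lam1_pos
      by (simp add: divide_nonpos_pos)
  qed
  show ?thesis
  proof (rule tendsto_zero_of_harmonic_drift)
    show "mean t (lyap z) \<ge> 0" for t by (intro mean_nonneg lyap_nonneg z)
    show "b t \<ge> 0" for t unfolding b_def by (intro mean_nonneg) auto
    show "decseq b" using dec by (rule decseq_SucI)
    show "lam1 / K > 0" using lam1_pos K by simp
    \<comment> \<open>With this weight the drift of \<open>1 / n\<close> yields
      \<open>- 2 * C / (n + 1) / r\<close>, which absorbs the error \<open>C / n / r\<close> because
      \<open>n \<ge> 1\<close>.\<close>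
    show "2 * C / lam1 \<ge> 0" using C lam1_pos by simp
    fix t
    have "mean (Suc t) (lyap z) + 2 * C / lam1 * b (Suc t)
        = mean t (\<lambda>x. (lyap z x + gen (lyap z) x / rate x)
            + 2 * C / lam1 * (1 / real (length x) + gen (\<lambda>x. 1 / real (length x)) x / rate x))"
      unfolding b_Suc mean_add mean_cmult mean_Suc by simp
    also have "\<dots> \<le> mean t (\<lambda>x. (lyap z x + 2 * C / lam1 * (1 / real (length x)))
        - lam1 / K / real (Suc t) * lyap z x)"
    proof (rule mean_mono)
      fix x assume xr: "x \<in> indeg_reach t"
      then have x: "x \<noteq> []" using indeg_reach_size by blast
      define n where "n = real (length x)"
      have n: "n \<ge> 1" using x by (cases x) (auto simp: n_def)
      define r where "r = rate x"
      have r: "r > 0" "r \<le> K * real (Suc t)" using rate_pos[OF x] rate_le[OF xr] by (auto simp: r_def K_def)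
      have l: "lyap z x \<ge> 0" by (rule lyap_nonneg[OF z])
      have "gen (lyap z) x / r \<le> (- lam1 * lyap z x + C / n) / r"
        using gen_lyap_le[OF z x] r by (intro divide_right_mono) (auto simp: C_def n_def)
      also have "\<dots> = - (lam1 * lyap z x / r) + C / n / r" by (simp add: diff_divide_distrib)
      also have "\<dots> \<le> - (lam1 / K / real (Suc t) * lyap z x) + C / n / r"
      proof -
        \<comment> \<open>The linear growth of the total rate in time produces the harmonic
          factor.\<close>
        have "lam1 * lyap z x / (K * real (Suc t)) \<le> lam1 * lyap z x / r"
          using r lam1_pos l by (intro divide_left_mono) auto
        then show ?thesis by simp
      qed
      finally have 1: "gen (lyap z) x / r \<le> - (lam1 / K / real (Suc t) * lyap z x) + C / n / r" .
      have "C / n \<le> C * (2 / (n + 1))"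
        using n C unfolding divide_inverse by (intro mult_left_mono) (auto simp: field_simps)
      then have "C / n / r \<le> C * (2 / (n + 1)) / r" using r by (intro divide_right_mono) auto
      then have 2: "2 * C / lam1 * (- lam1 / (n + 1) / r) \<le> - (C / n / r)"
        using lam1_pos by (simp add: mult.commute)
      have 3: "gen (\<lambda>x. 1 / real (length x)) x / rate x = - lam1 / (n + 1) / r"
        by (simp add: gen_inverse_length[OF x] n_def r_def)
      show "(lyap z x + gen (lyap z) x / rate x)
            + 2 * C / lam1 * (1 / real (length x) + gen (\<lambda>x. 1 / real (length x)) x / rate x)
         \<le> (lyap z x + 2 * C / lam1 * (1 / real (length x))) - lam1 / K / real (Suc t) * lyap z x"
        unfolding 3 unfolding n_def[symmetric] r_def[symmetric] distrib_left using 1 2 by linarith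
    qed
    also have "\<dots> = mean t (lyap z) + 2 * C / lam1 * b t - lam1 / K * mean t (lyap z) / real (Suc t)"
      unfolding mean_diff mean_add mean_cmult b_def by simp
    finally show "mean (Suc t) (lyap z) + 2 * C / lam1 * b (Suc t)
        \<le> mean t (lyap z) + 2 * C / lam1 * b t - lam1 / K * mean t (lyap z) / real (Suc t)" .
  qed
qed

text \<open>For \<open>w = \<bar>fluctuation z x 0\<bar>\<close> one has
  \<open>w \<le> h + w\<^sup>2 / h\<close>. Bounding \<open>w\<^sup>2\<close> by
  \<open>fluctuation_square_le_lyap\<close> with \<open>d = h\<^sup>2\<close> leaves
  \<open>K * h\<close> plus a multiple of \<open>lyap z x\<close>, whose mean vanishes as
  \<open>t\<close> grows with \<open>h\<close> fixed.\<close>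

lemma mean_degree_pgf_tendsto:
  assumes z: "0 \<le> z" "z \<le> 1"
  shows "(\<lambda>t. mean t (\<lambda>x. degree_pgf x z)) \<longlonglongrightarrow> resolvent lam1 (flow z) 0"
proof -
  define K where "K = 1 + 2 * (lam1 + lam2 + mu2)"
  have K: "K > 0" using lam1_pos lam2_pos mu2_nonneg by (simp add: K_def)
  have u: "\<bar>mean t (\<lambda>x. fluctuation z x 0)\<bar> \<le> K * h + exp (lam1 * h\<^sup>2) / h\<^sup>2 / h * mean t (lyap z)"
    if h: "h > 0" for h t
  proof -
    define E where "E = exp (lam1 * h\<^sup>2) / h\<^sup>2"
    have p: "\<bar>fluctuation z x 0\<bar> \<le> K * h + E / h * lyap z x" for x
    proof -
      define w where "w = \<bar>fluctuation z x 0\<bar>"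
      have "0 \<le> w * h" using h by (simp add: w_def)
      moreover have "w\<^sup>2 - 2 * (w * h) + h * h = (w - h)\<^sup>2"
        by (simp add: power2_eq_square algebra_simps)
      ultimately have "w * h \<le> h * h + w\<^sup>2"
        using zero_le_power2[of "w - h"] by linarith
      moreover have "w\<^sup>2 \<le> (K - 1) * h\<^sup>2 + E * lyap z x"
        using fluctuation_square_le_lyap[OF z, of "h\<^sup>2" x] h by (simp add: w_def K_def E_def)
      ultimately have "w * h \<le> (K * h + E / h * lyap z x) * h"
        using h by (simp add: algebra_simps power2_eq_square)
      then show ?thesis using h by (simp add: w_def)
    qed
    have "mean t (\<lambda>x. fluctuation z x 0) \<le> mean t (\<lambda>x. K * h + E / h * lyap z x)"
      using p by (intro mean_mono) (meson abs_le_D1)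
    moreover have "mean t (\<lambda>x. - 1 * fluctuation z x 0) \<le> mean t (\<lambda>x. K * h + E / h * lyap z x)"
      using p by (intro mean_mono) (simp add: abs_le_iff)
    ultimately show ?thesis
      unfolding mean_add mean_cmult mean_const E_def by linarith
  qed
  have "(\<lambda>t. mean t (\<lambda>x. fluctuation z x 0)) \<longlonglongrightarrow> 0"
  proof (rule LIMSEQ_I)
    fix e :: real assume e: "e > 0"
    define h where "h = e / (2 * K)"
    have h: "h > 0" "K * h = e / 2" using e K by (auto simp: h_def)
    define E where "E = exp (lam1 * h\<^sup>2) / h\<^sup>2 / h"
    have "(\<lambda>t. E * mean t (lyap z)) \<longlonglongrightarrow> E * 0"
      by (intro tendsto_intros mean_lyap_tendsto_0 z)
    then have "\<forall>\<^sub>F t in sequentially. E * mean t (lyap z) < e / 2"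
      using order_tendstoD(2)[of _ "E * 0" _ "e / 2"] e by auto
    then have "\<forall>\<^sub>F t in sequentially. norm (mean t (\<lambda>x. fluctuation z x 0) - 0) < e"
    proof eventually_elim
      fix t assume "E * mean t (lyap z) < e / 2"
      then show "norm (mean t (\<lambda>x. fluctuation z x 0) - 0) < e"
        using u[OF h(1), of t, folded E_def] h(2) by simp
    qed
    then show "\<exists>no. \<forall>t\<ge>no. norm (mean t (\<lambda>x. fluctuation z x 0) - 0) < e"
      by (simp add: eventually_sequentially)
  qed
  then have "(\<lambda>t. mean t (\<lambda>x. degree_pgf x z) - resolvent lam1 (flow z) 0) \<longlonglongrightarrow> 0"
    by (simp add: fluctuation_def mean_diff mean_const)
  then show ?thesis by (simp add: LIM_zero_iff)
qed

end

text \<open>By induction the coefficients below \<open>j\<close> converge, so the rest of the series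
  divided by \<open>z ^ j\<close>, called \<open>T\<close>, converges too. For small
  \<open>z\<close> it is close to coefficient \<open>j\<close>, uniformly over all coefficient
  sequences in the unit interval.\<close>

lemma coeff_tendsto_of_pgf_tendsto:
  fixes a :: "nat \<Rightarrow> nat \<Rightarrow> real"
  assumes a: "\<And>t j. 0 \<le> a t j \<and> a t j \<le> 1" and p: "\<And>j. 0 \<le> p j \<and> p j \<le> 1"
    and lim: "\<And>z. 0 < z \<Longrightarrow> z < 1 \<Longrightarrow> (\<lambda>t. \<Sum>j. a t j * z ^ j) \<longlonglongrightarrow> (\<Sum>j. p j * z ^ j)"
  shows "(\<lambda>t. a t j) \<longlonglongrightarrow> p j"
proof (induction j rule: less_induct)
  case (less j)
  define T where "T = (\<lambda>(q :: nat \<Rightarrow> real) z. \<Sum>k. q (k + j) * z ^ k)"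
  have sm: "summable (\<lambda>k. q (k + i) * z ^ k)"
    if "\<And>j. 0 \<le> q j \<and> q j \<le> 1" "0 < z" "z < 1" for q :: "nat \<Rightarrow> real" and z i
  proof (rule summable_comparison_test'[of "\<lambda>k. z ^ k" 0])
    show "summable (\<lambda>k. z ^ k)" using that by (intro summable_geometric) auto
    show "norm (q (k + i) * z ^ k) \<le> z ^ k" for k
      using that(1)[of "k + i"] that(2) by (auto simp: abs_mult intro: mult_left_le_one_le)
  qed
  have T: "T q z = ((\<Sum>k. q k * z ^ k) - (\<Sum>i<j. q i * z ^ i)) / z ^ j"
    if "\<And>j. 0 \<le> q j \<and> q j \<le> 1" "0 < z" "z < 1" for q :: "nat \<Rightarrow> real" and z
  proof -
    have "(\<Sum>k. q k * z ^ k) = (\<Sum>k. q (k + j) * z ^ (k + j)) + (\<Sum>i<j. q i * z ^ i)"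
      using sm[OF that, of "\<lambda>i. i" 0] by (intro suminf_split_initial_segment) simp
    also have "(\<Sum>k. q (k + j) * z ^ (k + j)) = (\<Sum>k. z ^ j * (q (k + j) * z ^ k))"
      by (simp add: power_add mult_ac)
    also have "\<dots> = z ^ j * T q z" unfolding T_def by (rule suminf_mult[OF sm[OF that]])
    finally show ?thesis using that by simp
  qed
  have near: "0 \<le> T q z - q j" "T q z - q j \<le> z / (1 - z)"
    if q: "\<And>j. 0 \<le> q j \<and> q j \<le> 1" and z: "0 < z" "z < 1" for q :: "nat \<Rightarrow> real" and z
  proof -
    have s: "summable (\<lambda>k. z * (q (k + Suc j) * z ^ k))"
      by (intro summable_mult sm q z)
    have e: "T q z - q j = (\<Sum>k. z * (q (k + Suc j) * z ^ k))"
      using suminf_split_head[OF sm[OF q z, of "\<lambda>i. i" j]] by (simp add: T_def mult_ac)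
    show "0 \<le> T q z - q j"
      unfolding e using q z by (intro suminf_nonneg s) auto
    have "(\<Sum>k. z * (q (k + Suc j) * z ^ k)) \<le> (\<Sum>k. z * z ^ k)"
      using q z by (intro suminf_le s summable_mult summable_geometric mult_left_mono)
        (auto intro: mult_left_le_one_le)
    also have "\<dots> = z * (1 / (1 - z))"
      using z by (simp add: suminf_mult summable_geometric suminf_geometric)
    finally show "T q z - q j \<le> z / (1 - z)" unfolding e by simp
  qed
  show ?case
  proof (rule LIMSEQ_I)
    fix e :: real assume e: "e > 0"
    \<comment> \<open>The solution of \<open>z / (1 - z) = e / 2\<close>. The gaps
      \<open>T q z - q j\<close> for \<open>a t\<close> and \<open>p\<close> both lie between
      \<open>0\<close> and \<open>e / 2\<close>, so they differ by at most
      \<open>e / 2\<close>.\<close>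
    define z where "z = e / (e + 2)"
    have z: "0 < z" "z < 1" and ze: "z / (1 - z) = e / 2"
      using e by (auto simp: z_def field_simps)
    have "(\<lambda>t. T (a t) z) \<longlonglongrightarrow> T p z"
      using z unfolding T[OF a z] T[OF p z]
      by (intro tendsto_intros lim less.IH) auto
    then have "\<forall>\<^sub>F t in sequentially. \<bar>T (a t) z - T p z\<bar> < e / 2"
      using tendstoD[of _ "T p z" _ "e / 2"] e by (auto simp: dist_real_def)
    then have "\<forall>\<^sub>F t in sequentially. norm (a t j - p j) < e"
    proof eventually_elim
      fix t assume "\<bar>T (a t) z - T p z\<bar> < e / 2"
      then show "norm (a t j - p j) < e"
        using near[of "a t", OF a z] near[of p, OF p z] unfolding ze real_norm_def by linarith
    qed
    then show "\<exists>no. \<forall>t\<ge>no. norm (a t j - p j) < e"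
      by (simp add: eventually_sequentially)
  qed
qed

section \<open>The limit law and its generating function\<close>

context indegree_params
begin

text \<open>The distribution at time \<open>a\<close> of the linear birth-death process started from one individual.\<close>

definition bd_prob :: "nat \<Rightarrow> real \<Rightarrow> real" where
  "bd_prob j a = (if j = 0 then mu2 * mean_integral a / (1 + lam2 * mean_integral a)
     else exp (growth * a) * (lam2 * mean_integral a) ^ (j - 1) / (1 + lam2 * mean_integral a) ^ (j + 1))"

definition limit_prob :: "nat \<Rightarrow> real" where
  "limit_prob j = integral {0..} (\<lambda>a. lam1 * exp (- lam1 * a) * bd_prob j a)"

lemma bd_prob_denominator_pos: "a \<ge> 0 \<Longrightarrow> 1 + lam2 * mean_integral a > 0"
  using flow_denominator_pos[of 0 a] by simp

lemma bd_prob_nonneg: "a \<ge> 0 \<Longrightarrow> 0 \<le> bd_prob j a"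
  using bd_prob_denominator_pos[of a] mean_integral_nonneg[of a] lam2_pos mu2_nonneg
  by (auto simp: bd_prob_def)

lemma continuous_on_bd_prob: "continuous_on {0..} (bd_prob j)"
proof -
  have "\<forall>a\<in>{0..}. 1 + lam2 * mean_integral a \<noteq> 0" using bd_prob_denominator_pos by fastforce
  then show ?thesis unfolding bd_prob_def by (cases "j = 0") (auto intro!: continuous_intros)
qed

text \<open>The terms with \<open>j \<ge> 1\<close> form a geometric series of ratio
  \<open>g * z / D\<close>. The identity \<open>mu2 * mean_integral a = D - E\<close> rewrites the
  term \<open>j = 0\<close> as \<open>(D - E) / D\<close>.\<close>

lemma bd_prob_sums:
  assumes z: "0 \<le> z" "z \<le> 1" and a: "a \<ge> 0"
  shows "(\<lambda>j. bd_prob j a * z ^ j) sums flow z a"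
proof -
  define g where "g = lam2 * mean_integral a"
  define E where "E = exp (growth * a)"
  define D where "D = 1 + g"
  have g: "g \<ge> 0" using mean_integral_nonneg[OF a] lam2_pos by (simp add: g_def)
  have D: "D > 0" using g by (simp add: D_def)
  have gz: "g * z \<le> g" using g z by (simp add: mult_left_le)
  have pos: "D - g * z > 0" using gz by (simp add: D_def)
  have m: "mu2 * mean_integral a = D - E"
    using exp_growth[of a] by (simp add: D_def E_def g_def algebra_simps)
  have "(\<lambda>k. z * E / D\<^sup>2 * (g * z / D) ^ k) sums (z * E / D\<^sup>2 * (1 / (1 - g * z / D)))"
    using g z pos D by (intro sums_mult geometric_sums) (auto simp: abs_mult)
  also have "(\<lambda>k. z * E / D\<^sup>2 * (g * z / D) ^ k) = (\<lambda>k. bd_prob (Suc k) a * z ^ Suc k)"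
    by (simp add: bd_prob_def D_def E_def g_def power_divide power_mult_distrib power2_eq_square mult_ac fun_eq_iff)
  also have "z * E / D\<^sup>2 * (1 / (1 - g * z / D)) = flow z a - bd_prob 0 a * z ^ 0"
  proof -
    have "1 - g * z / D = (D - g * z) / D" using D by (simp add: diff_divide_distrib)
    then have "z * E / D\<^sup>2 * (1 / (1 - g * z / D)) = z * E / (D * (D - g * z))"
      using D by (simp add: power2_eq_square)
    also have "\<dots> = (1 - (1 - z) * E / (D - g * z)) - (D - E) / D"
      using D pos by (simp add: divide_simps) (simp add: D_def algebra_simps)
    also have "\<dots> = flow z a - bd_prob 0 a * z ^ 0"
      unfolding bd_prob_def flow_def m[symmetric]
      by (simp add: D_def g_def E_def algebra_simps)
    finally show ?thesis .
  qed
  finally show ?thesis using sums_Suc[of "\<lambda>j. bd_prob j a * z ^ j"] by fastforce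
qed

lemma bd_prob_le_1:
  assumes "a \<ge> 0"
  shows "bd_prob j a \<le> 1"
proof -
  have "bd_prob j a = (\<Sum>i\<in>{j}. bd_prob i a * 1 ^ i)" by simp
  also have "\<dots> \<le> flow 1 a"
    using sums_le[OF _ sums_If_finite_set[of "{j}" "\<lambda>i. bd_prob i a * 1 ^ i"] bd_prob_sums[of 1 a]]
      assms bd_prob_nonneg by auto
  also have "\<dots> = 1" by (simp add: flow_def)
  finally show ?thesis .
qed

lemma limit_prob_has_integral:
  "((\<lambda>a. lam1 * exp (- lam1 * a) * bd_prob j a) has_integral limit_prob j) {0..}"
  unfolding limit_prob_def mult.assoc
proof (intro integrable_integral integrable_on_mult_right set_lebesgue_integral_eq_integral(1)
    integrable_on_exp_times_bounded lam1_pos continuous_on_bd_prob)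
  show "\<bar>bd_prob j s\<bar> \<le> 1" if "s \<ge> 0" for s
    using bd_prob_nonneg[OF that] bd_prob_le_1[OF that] by simp
qed

lemma limit_prob_bounds: "0 \<le> limit_prob j" "limit_prob j \<le> 1"
proof -
  show "0 \<le> limit_prob j"
    using bd_prob_nonneg lam1_pos by (intro has_integral_nonneg[OF limit_prob_has_integral]) auto
  show "limit_prob j \<le> 1"
    using bd_prob_le_1 lam1_pos
    by (intro has_integral_le[OF limit_prob_has_integral has_integral_exp_density[OF lam1_pos]])
       (auto simp: mult_left_le)
qed

text \<open>Sum and integral are exchanged by dominated convergence: the partial sums are at most
  \<open>flow z a \<le> 1\<close>, so the exponential density dominates.\<close>

lemma limit_prob_sums:
  assumes z: "0 \<le> z" "z \<le> 1"
  shows "(\<lambda>j. limit_prob j * z ^ j) sums resolvent lam1 (flow z) 0"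
proof -
  define f where "f = (\<lambda>n a. \<Sum>j<n. lam1 * exp (- lam1 * a) * bd_prob j a * z ^ j)"
  have f: "(f n has_integral (\<Sum>j<n. limit_prob j * z ^ j)) {0..}" for n
    unfolding f_def
    by (intro has_integral_sum has_integral_mult_left limit_prob_has_integral) auto
  have fe: "f n a = lam1 * exp (- lam1 * a) * (\<Sum>j<n. bd_prob j a * z ^ j)" for n a
    by (simp add: f_def sum_distrib_left mult_ac)
  have "(\<lambda>n. integral {0..} (f n)) \<longlonglongrightarrow> integral {0..} (\<lambda>a. lam1 * exp (- lam1 * a) * flow z a)"
  proof (rule dominated_convergence(2))
    show "f n integrable_on {0..}" for n using f by blast
    show "(\<lambda>a. lam1 * exp (- lam1 * a)) integrable_on {0..}"
      using has_integral_exp_density[OF lam1_pos] by blast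
    fix a :: real assume "a \<in> {0..}"
    then have a: "a \<ge> 0" by simp
    show "norm (f n a) \<le> lam1 * exp (- lam1 * a)" for n
    proof -
      have 0: "0 \<le> (\<Sum>j<n. bd_prob j a * z ^ j)" using bd_prob_nonneg[OF a] z by (intro sum_nonneg) auto
      have "(\<Sum>j<n. bd_prob j a * z ^ j) \<le> flow z a"
        using sum_le_suminf[OF sums_summable[OF bd_prob_sums[OF z a]], of "{..<n}"] bd_prob_nonneg[OF a] z
        by (simp add: sums_unique[OF bd_prob_sums[OF z a], symmetric])
      also have "\<dots> \<le> 1" by (rule flow_bounds[OF z a])
      finally show ?thesis using 0 lam1_pos by (simp add: fe abs_mult mult_left_le)
    qed
    show "(\<lambda>n. f n a) \<longlonglongrightarrow> lam1 * exp (- lam1 * a) * flow z a"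
      unfolding fe using bd_prob_sums[OF z a] unfolding sums_def by (intro tendsto_intros)
  qed
  then show ?thesis
    unfolding sums_def resolvent_0 by (simp add: integral_unique[OF f])
qed

end

context indegree_process
begin

lemma prob_tendsto_limit_prob:
  assumes u: "\<And>t. uniform_vertex_indegree M (d t) (V t)"
  shows "(\<lambda>t. \<P>(\<omega> in M. V t \<omega> = j)) \<longlonglongrightarrow> limit_prob j"
proof (rule coeff_tendsto_of_pgf_tendsto)
  fix z :: real assume z: "0 < z" "z < 1"
  show "(\<lambda>t. \<Sum>j. \<P>(\<omega> in M. V t \<omega> = j) * z ^ j) \<longlonglongrightarrow> (\<Sum>j. limit_prob j * z ^ j)"
    using mean_degree_pgf_tendsto[of z] limit_prob_sums[of z] z
    by (simp add: sums_unique[OF mean_degree_pgf[OF u], symmetric] sums_iff)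
qed (use limit_prob_bounds in auto)

end

subsection \<open>Special functions\<close>

text \<open>The substitution takes place on the open half line, where \<open>g\<close> is a
  differentiable bijection onto the interior of \<open>T\<close>. The boundary of the convex set
  \<open>T\<close> is negligible, and nonnegativity of \<open>h\<close> upgrades integrability to
  absolute integrability.\<close>

lemma integral_change_of_variables_half_line:
  fixes f g g' h :: "real \<Rightarrow> real"
  assumes g: "\<And>a. a > 0 \<Longrightarrow> (g has_real_derivative g' a) (at a)" and inj: "inj_on g {0<..}"
    and im: "g ` {0<..} = interior T" and T: "convex T"
    and h: "h integrable_on {0..}" "\<And>a. a > 0 \<Longrightarrow> h a \<ge> 0"
    and c: "c > 0" and eq: "\<And>a. a > 0 \<Longrightarrow> h a = c * (\<bar>g' a\<bar> * f (g a))"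
  shows "integral {0..} h = c * integral T f"
proof -
  have h': "h integrable_on {0<..}"
    using h(1) by (rule integrable_spike_set) (auto intro!: negligible_subset[OF negligible_sing[of "0::real"]])
  have hi: "integral {0..} h = integral {0<..} h"
    by (rule integral_spike_set) (auto intro!: negligible_subset[OF negligible_sing[of "0::real"]])
  have e: "1 / c * h a = \<bar>g' a\<bar> * f (g a)" if "a \<in> {0<..}" for a
    using eq that c by simp
  have "(\<lambda>a. 1 / c * h a) absolutely_integrable_on {0<..}"
    using h h' c by (intro nonnegative_absolutely_integrable_1 integrable_on_mult_right) auto
  then have "(\<lambda>a. \<bar>g' a\<bar> * f (g a)) absolutely_integrable_on {0<..}"
    using set_integrable_cong[where f = "\<lambda>a. 1 / c * h a" and f' = "\<lambda>a. \<bar>g' a\<bar> * f (g a)", OF refl refl e]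
    by blast
  then have "integral (interior T) f = integral {0<..} (\<lambda>a. \<bar>g' a\<bar> * f (g a))"
    using has_absolute_integral_change_of_variables_1'[of "{0<..}" g g' f] g inj unfolding im
    by (auto intro: has_field_derivative_at_within)
  also have "\<dots> = integral {0<..} (\<lambda>a. 1 / c * h a)"
    by (intro integral_cong) (use e in auto)
  also have "\<dots> = 1 / c * integral {0..} h" unfolding hi by simp
  also have "integral (interior T) f = integral T f"
  proof (rule integral_spike_set)
    have "negligible (frontier T)" using T by (rule negligible_convex_frontier)
    then show "negligible {x \<in> interior T - T. f x \<noteq> 0}" "negligible {x \<in> T - interior T. f x \<noteq> 0}"
      using interior_subset[of T] closure_subset[of T]
      by (auto intro: negligible_subset simp: frontier_def)
  qed
  finally show ?thesis using c by simp
qed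

lemma integral_exp_substitution:
  fixes f h :: "real \<Rightarrow> real"
  assumes k: "k > 0" and h: "h integrable_on {0..}" "\<And>a. a > 0 \<Longrightarrow> h a \<ge> 0" and c: "c > 0"
    and eq: "\<And>a. a > 0 \<Longrightarrow> h a = c * (k * exp (- k * a) * f (exp (- k * a)))"
  shows "integral {0..} h = c * integral {0..1} f"
proof (rule integral_change_of_variables_half_line[where g = "\<lambda>a. exp (- k * a)" and g' = "\<lambda>a. - k * exp (- k * a)"])
  show "(\<lambda>a. exp (- k * a)) ` {0<..} = interior {0..1}"
  proof -
    have "s \<in> (\<lambda>a. exp (- k * a)) ` {0<..}" if "0 < s" "s < 1" for s
      using that k by (intro image_eqI[of _ _ "- ln s / k"]) (auto simp: divide_neg_pos)
    then show ?thesis using k by auto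
  qed
qed (use k h c eq in \<open>auto intro!: derivative_eq_intros inj_onI simp: abs_mult\<close>)

lemma exp_powr:
  fixes a k r :: real
  assumes "k > 0"
  shows "exp (- k * a) powr (r / k) = exp (- r * a)"
  using assms by (simp add: powr_def)

text \<open>The Beta factor in the formulas for the limits is, by symmetry, the normalising constant
  of \<open>gauss_F\<close>, so only the bare integral remains to be matched.\<close>

lemma Beta_times_gauss_F:
  assumes "b > 0" "c > b"
  shows "Beta (c - b) b * gauss_F a b c z =
    integral {0..1} (\<lambda>s. s powr (b - 1) * ((1 - s) powr (c - b - 1) / (1 - s * z) powr a))"
proof -
  have "Beta b (c - b) > 0"
    using assms by (auto simp: Beta_def intro!: divide_pos_pos mult_pos_pos Gamma_real_pos)
  then show ?thesis by (simp add: gauss_F_def Beta_commute[of "c - b"])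
qed

text \<open>For \<open>bd_prob j\<close> with \<open>j = m + 1\<close> the exponents above and below
  are \<open>j - 1\<close> and \<open>j + 1\<close>, so a common factor \<open>c\<close> survives
  only as \<open>c\<^sup>2\<close>.\<close>

lemma cancel_common_power:
  fixes c :: real
  assumes "c \<noteq> 0"
  shows "A * (c * X) ^ m / (c * Y) ^ (m + 2) = A * X ^ m / (c\<^sup>2 * Y ^ (m + 2))"
proof -
  have "(c * Y) ^ (m + 2) = c ^ m * (c\<^sup>2 * Y ^ (m + 2))"
    by (simp add: power_mult_distrib power_add power2_eq_square mult_ac)
  then show ?thesis using assms by (simp add: power_mult_distrib)
qed

section \<open>Closed forms of the limit in the four regimes\<close>

context indegree_params
begin

lemma limit_prob_integrand:
  "(\<lambda>a. lam1 * exp (- lam1 * a) * bd_prob j a) integrable_on {0..}"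
  "a > 0 \<Longrightarrow> 0 \<le> lam1 * exp (- lam1 * a) * bd_prob j a"
  using limit_prob_has_integral[of j] bd_prob_nonneg[of a j] lam1_pos by auto

lemma limit_prob_0_immortal: "mu2 = 0 \<Longrightarrow> limit_prob 0 = 0"
  unfolding limit_prob_def bd_prob_def by simp

text \<open>Without deaths the process is the Yule process, whose law is geometric:
  \<open>bd_prob j a = s * (1 - s) ^ (j - 1)\<close> for
  \<open>s = exp (- lam2 * a)\<close>.\<close>

lemma limit_prob_immortal:
  assumes "mu2 = 0" and j: "j \<ge> 1"
  shows "limit_prob j = lam1 / lam2 * Beta (real j) (1 + lam1 / lam2)"
proof -
  obtain m where m: "j = Suc m" using j by (cases j) auto
  have "limit_prob j = lam1 / lam2 *
      integral {0..1} (\<lambda>s. s powr ((1 + lam1 / lam2) - 1) * (1 - s) powr (real j - 1))"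
    unfolding limit_prob_def
  proof (rule integral_exp_substitution[OF lam2_pos limit_prob_integrand])
    fix a :: real assume a: "a > 0"
    define s where "s = exp (- lam2 * a)"
    have s: "0 < s" "s < 1" using a lam2_pos by (auto simp: s_def)
    have E: "exp (growth * a) = 1 / s" using assms by (simp add: s_def exp_minus field_simps)
    have g: "lam2 * mean_integral a = (1 - s) / s"
      using exp_growth[of a] assms s unfolding E by (simp add: field_simps)
    have "bd_prob j a = 1 / s * ((1 - s) / s) ^ m / (1 / s) ^ (m + 2)"
    proof -
      have "1 + (1 - s) / s = 1 / s" using s by (simp add: field_simps)
      then show ?thesis unfolding bd_prob_def E g by (simp add: m)
    qed
    also have "\<dots> = s * (1 - s) ^ m" using s by (simp add: field_simps power2_eq_square)
    finally have b: "bd_prob j a = s * (1 - s) ^ m" .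
    have p: "(1 - s) powr (real j - 1) = (1 - s) ^ m" using s by (simp add: m powr_realpow)
    show "lam1 * exp (- lam1 * a) * bd_prob j a = lam1 / lam2 * (lam2 * exp (- lam2 * a) *
        (exp (- lam2 * a) powr ((1 + lam1 / lam2) - 1) * (1 - exp (- lam2 * a)) powr (real j - 1)))"
      unfolding b s_def[symmetric] p
      using lam2_pos exp_powr[OF lam2_pos, of a lam1, folded s_def] by simp
  qed (use lam1_pos lam2_pos in auto)
  also have "\<dots> = lam1 / lam2 * Beta (1 + lam1 / lam2) (real j)"
    using j lam1_pos lam2_pos by (subst Beta_eq_integral) (auto intro: add_pos_pos)
  finally show ?thesis by (simp add: Beta_commute)
qed

lemma limit_prob_0_supercritical:
  assumes "mu2 > 0" "lam2 > mu2"
  shows "limit_prob 0 = mu2 * lam1 / (lam2 * (lam2 - mu2)) * Beta 2 (lam1 / (lam2 - mu2)) *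
     gauss_F 1 (lam1 / (lam2 - mu2)) (2 + lam1 / (lam2 - mu2)) (mu2 / lam2)"
proof -
  define k where "k = lam2 - mu2"
  define z where "z = mu2 / lam2"
  define q where "q = lam1 / k"
  have k: "k > 0" and z: "0 < z" "z < 1" using assms by (auto simp: k_def z_def)
  have q: "q > 0" using lam1_pos k by (simp add: q_def)
  have "limit_prob 0 = mu2 * lam1 / (lam2 * k) *
      integral {0..1} (\<lambda>s. s powr (q - 1) * ((1 - s) powr ((2 + q) - q - 1) / (1 - s * z) powr 1))"
    unfolding limit_prob_def
  proof (rule integral_exp_substitution[OF k limit_prob_integrand])
    fix a :: real assume a: "a > 0"
    define s where "s = exp (- k * a)"
    have s: "0 < s" "s < 1" using a k by (auto simp: s_def)
    have sz: "s * z < 1" using mult_strict_mono[of s 1 z 1] s z by simp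
    have "exp (growth * a) * s = 1"
      unfolding s_def k_def exp_add[symmetric] by (simp add: algebra_simps)
    then have E: "exp (growth * a) = 1 / s" using s by (simp add: field_simps)
    have g: "mean_integral a = (1 - s) / (k * s)"
      using exp_growth[of a] k s unfolding E unfolding k_def[symmetric] by (simp add: field_simps)
    have d: "1 + lam2 * mean_integral a = lam2 * (1 - s * z) / (k * s)"
      unfolding g using k s lam2_pos by (simp add: field_simps z_def) (simp add: k_def algebra_simps)
    have b: "bd_prob 0 a = mu2 / lam2 * (1 - s) / (1 - s * z)"
      unfolding bd_prob_def d unfolding g using k s lam2_pos sz by simp
    \<comment> \<open>The factor \<open>s\<close> goes into the Jacobian
      \<open>k * exp (- k * a)\<close>, leaving the exponent \<open>q - 1\<close>. For
      \<open>j \<ge> 1\<close> that factor comes from \<open>bd_prob j a\<close> instead, so the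
      exponent there is \<open>q\<close>.\<close>
    have "exp (- lam1 * a) = s * s powr (q - 1)"
      using exp_powr[OF k, of a lam1, folded s_def] s by (simp add: q_def powr_diff)
    then show "lam1 * exp (- lam1 * a) * bd_prob 0 a = mu2 * lam1 / (lam2 * k) * (k * exp (- k * a) *
      (exp (- k * a) powr (q - 1) * ((1 - exp (- k * a)) powr ((2 + q) - q - 1) / (1 - exp (- k * a) * z) powr 1)))"
      unfolding b s_def[symmetric] using k s lam2_pos sz by simp
  qed (use lam1_pos lam2_pos k assms in auto)
  then show ?thesis
    using Beta_times_gauss_F[of q "2 + q" 1 z] q by (simp add: k_def q_def z_def)
qed

lemma limit_prob_supercritical:
  assumes "mu2 > 0" "lam2 > mu2" and j: "j \<ge> 1"
  shows "limit_prob j = lam1 * (lam2 - mu2) / lam2\<^sup>2 * Beta (real j) (1 + lam1 / (lam2 - mu2)) *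
     gauss_F (real j + 1) (1 + lam1 / (lam2 - mu2)) (real j + 1 + lam1 / (lam2 - mu2)) (mu2 / lam2)"
proof -
  obtain m where m: "j = Suc m" using j by (cases j) auto
  define k where "k = lam2 - mu2"
  define z where "z = mu2 / lam2"
  define q where "q = lam1 / k"
  have k: "k > 0" and z: "0 < z" "z < 1" using assms by (auto simp: k_def z_def)
  have q: "q > 0" using lam1_pos k by (simp add: q_def)
  have "limit_prob j = lam1 * k / lam2\<^sup>2 *
      integral {0..1} (\<lambda>s. s powr ((1 + q) - 1) *
        ((1 - s) powr ((real j + 1 + q) - (1 + q) - 1) / (1 - s * z) powr (real j + 1)))"
    unfolding limit_prob_def
  proof (rule integral_exp_substitution[OF k limit_prob_integrand])
    fix a :: real assume a: "a > 0"
    define s where "s = exp (- k * a)"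
    have s: "0 < s" "s < 1" using a k by (auto simp: s_def)
    have sz: "s * z < 1" using mult_strict_mono[of s 1 z 1] s z by simp
    have "exp (growth * a) * s = 1"
      unfolding s_def k_def exp_add[symmetric] by (simp add: algebra_simps)
    then have E: "exp (growth * a) = 1 / s" using s by (simp add: field_simps)
    have g: "mean_integral a = (1 - s) / (k * s)"
      using exp_growth[of a] k s unfolding E unfolding k_def[symmetric] by (simp add: field_simps)
    have d: "1 + lam2 * mean_integral a = lam2 * (1 - s * z) / (k * s)"
      unfolding g using k s lam2_pos by (simp add: field_simps z_def) (simp add: k_def algebra_simps)
    have b: "bd_prob j a = k\<^sup>2 / lam2\<^sup>2 * s * (1 - s) ^ m / (1 - s * z) ^ (m + 2)"
    proof -
      \<comment> \<open>Both \<open>lam2 * mean_integral a\<close> and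
        \<open>1 + lam2 * mean_integral a\<close> contain the factor
        \<open>lam2 / (k * s)\<close>.\<close>
      have "bd_prob j a = 1 / s * (lam2 / (k * s) * (1 - s)) ^ m / (lam2 / (k * s) * (1 - s * z)) ^ (m + 2)"
        unfolding bd_prob_def d E unfolding g by (simp add: m)
      also have "\<dots> = 1 / s * (1 - s) ^ m / ((lam2 / (k * s))\<^sup>2 * (1 - s * z) ^ (m + 2))"
        using k s lam2_pos by (intro cancel_common_power) simp
      also have "\<dots> = k\<^sup>2 / lam2\<^sup>2 * s * (1 - s) ^ m / (1 - s * z) ^ (m + 2)"
        using k s lam2_pos sz by (simp add: power2_eq_square)
      finally show ?thesis .
    qed
    have p: "(1 - s) powr ((real j + 1 + q) - (1 + q) - 1) = (1 - s) ^ m" "(1 - s * z) powr (real j + 1) = (1 - s * z) ^ (m + 2)"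
      using s sz powr_realpow[of "1 - s * z" "m + 2"] powr_realpow[of "1 - s" m] by (simp_all add: m add.commute)
    have "exp (- lam1 * a) = s powr ((1 + q) - 1)"
      using exp_powr[OF k, of a lam1] by (simp add: s_def q_def)
    then show "lam1 * exp (- lam1 * a) * bd_prob j a = lam1 * k / lam2\<^sup>2 * (k * exp (- k * a) *
      (exp (- k * a) powr ((1 + q) - 1) * ((1 - exp (- k * a)) powr ((real j + 1 + q) - (1 + q) - 1)
        / (1 - exp (- k * a) * z) powr (real j + 1))))"
      unfolding b s_def[symmetric] p by (simp add: power2_eq_square)
  qed (use lam1_pos lam2_pos k in auto)
  also have "\<dots> = lam1 * k / lam2\<^sup>2 * (Beta (real j + 1 + q - (1 + q)) (1 + q) * gauss_F (real j + 1) (1 + q) (real j + 1 + q) z)"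
    using q j by (subst Beta_times_gauss_F) auto
  finally show ?thesis by (simp add: k_def q_def z_def)
qed

lemma limit_prob_0_subcritical:
  assumes "lam2 < mu2"
  shows "limit_prob 0 = lam1 / (mu2 - lam2) * Beta 2 (lam1 / (mu2 - lam2)) *
     gauss_F 1 (lam1 / (mu2 - lam2)) (2 + lam1 / (mu2 - lam2)) (lam2 / mu2)"
proof -
  define k where "k = mu2 - lam2"
  define z where "z = lam2 / mu2"
  define q where "q = lam1 / k"
  have m0: "mu2 > 0" using assms lam2_pos by simp
  have k: "k > 0" and z: "0 < z" "z < 1" using assms m0 lam2_pos by (auto simp: k_def z_def)
  have q: "q > 0" using lam1_pos k by (simp add: q_def)
  have "limit_prob 0 = lam1 / k *
      integral {0..1} (\<lambda>s. s powr (q - 1) * ((1 - s) powr ((2 + q) - q - 1) / (1 - s * z) powr 1))"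
    unfolding limit_prob_def
  proof (rule integral_exp_substitution[OF k limit_prob_integrand])
    fix a :: real assume a: "a > 0"
    define s where "s = exp (- k * a)"
    have s: "0 < s" "s < 1" using a k by (auto simp: s_def)
    have sz: "s * z < 1" using mult_strict_mono[of s 1 z 1] s z by simp
    have gk: "growth = - k" by (simp add: k_def)
    have E: "exp (growth * a) = s" by (simp add: s_def gk)
    have g: "mean_integral a = (1 - s) / k"
      using exp_growth[of a] k unfolding E unfolding gk by (simp add: field_simps)
    have d: "1 + lam2 * mean_integral a = mu2 * (1 - s * z) / k"
      unfolding g using k m0 by (simp add: field_simps z_def) (simp add: k_def algebra_simps)
    have b: "bd_prob 0 a = (1 - s) / (1 - s * z)"
      unfolding bd_prob_def d unfolding g using k m0 sz by simp
    have "exp (- lam1 * a) = s * s powr (q - 1)"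
      using exp_powr[OF k, of a lam1, folded s_def] s by (simp add: q_def powr_diff)
    then show "lam1 * exp (- lam1 * a) * bd_prob 0 a = lam1 / k * (k * exp (- k * a) *
      (exp (- k * a) powr (q - 1) * ((1 - exp (- k * a)) powr ((2 + q) - q - 1) / (1 - exp (- k * a) * z) powr 1)))"
      unfolding b s_def[symmetric] using k s sz by simp
  qed (use lam1_pos k in auto)
  then show ?thesis
    using Beta_times_gauss_F[of q "2 + q" 1 z] q by (simp add: k_def q_def z_def)
qed

text \<open>Here \<open>growth\<close> is \<open>- k\<close>, so the exponential in
  \<open>bd_prob\<close> is \<open>s\<close> itself. After cancelling \<open>mu2 / k\<close>, the
  numerator retains \<open>z * (1 - s)\<close> to the power \<open>j - 1\<close>; this is the source
  of the exponent of \<open>lam2 / mu2\<close>.\<close>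

lemma limit_prob_subcritical:
  assumes "lam2 < mu2" and j: "j \<ge> 1"
  shows "limit_prob j = (lam2 / mu2) ^ (j - 1) * (lam1 * (mu2 - lam2) / mu2\<^sup>2) * Beta (real j) (1 + lam1 / (mu2 - lam2)) *
     gauss_F (real j + 1) (1 + lam1 / (mu2 - lam2)) (real j + 1 + lam1 / (mu2 - lam2)) (lam2 / mu2)"
proof -
  obtain m where m: "j = Suc m" using j by (cases j) auto
  define k where "k = mu2 - lam2"
  define z where "z = lam2 / mu2"
  define q where "q = lam1 / k"
  have m0: "mu2 > 0" using assms lam2_pos by simp
  have k: "k > 0" and z: "0 < z" "z < 1" using assms m0 lam2_pos by (auto simp: k_def z_def)
  have q: "q > 0" using lam1_pos k by (simp add: q_def)
  have "limit_prob j = z ^ m * (lam1 * k / mu2\<^sup>2) *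
      integral {0..1} (\<lambda>s. s powr ((1 + q) - 1) *
        ((1 - s) powr ((real j + 1 + q) - (1 + q) - 1) / (1 - s * z) powr (real j + 1)))"
    unfolding limit_prob_def
  proof (rule integral_exp_substitution[OF k limit_prob_integrand])
    fix a :: real assume a: "a > 0"
    define s where "s = exp (- k * a)"
    have s: "0 < s" "s < 1" using a k by (auto simp: s_def)
    have sz: "s * z < 1" using mult_strict_mono[of s 1 z 1] s z by simp
    have gk: "growth = - k" by (simp add: k_def)
    have E: "exp (growth * a) = s" by (simp add: s_def gk)
    have g: "mean_integral a = (1 - s) / k"
      using exp_growth[of a] k unfolding E unfolding gk by (simp add: field_simps)
    have d: "1 + lam2 * mean_integral a = mu2 / k * (1 - s * z)"
      unfolding g using k m0 by (simp add: field_simps z_def) (simp add: k_def algebra_simps)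
    have l: "lam2 * mean_integral a = mu2 / k * (z * (1 - s))"
      unfolding g using m0 by (simp add: z_def)
    have b: "bd_prob j a = z ^ m * k\<^sup>2 / mu2\<^sup>2 * s * (1 - s) ^ m / (1 - s * z) ^ (m + 2)"
    proof -
      have "bd_prob j a = s * (mu2 / k * (z * (1 - s))) ^ m / (mu2 / k * (1 - s * z)) ^ (m + 2)"
        unfolding bd_prob_def d E unfolding l by (simp add: m)
      also have "\<dots> = s * (z * (1 - s)) ^ m / ((mu2 / k)\<^sup>2 * (1 - s * z) ^ (m + 2))"
        using k m0 by (intro cancel_common_power) simp
      also have "\<dots> = z ^ m * k\<^sup>2 / mu2\<^sup>2 * s * (1 - s) ^ m / (1 - s * z) ^ (m + 2)"
        using k m0 sz by (simp add: power2_eq_square power_mult_distrib)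
      finally show ?thesis .
    qed
    have p: "(1 - s) powr ((real j + 1 + q) - (1 + q) - 1) = (1 - s) ^ m" "(1 - s * z) powr (real j + 1) = (1 - s * z) ^ (m + 2)"
      using s sz powr_realpow[of "1 - s * z" "m + 2"] powr_realpow[of "1 - s" m] by (simp_all add: m add.commute)
    have "exp (- lam1 * a) = s powr ((1 + q) - 1)"
      using exp_powr[OF k, of a lam1] by (simp add: s_def q_def)
    then show "lam1 * exp (- lam1 * a) * bd_prob j a = z ^ m * (lam1 * k / mu2\<^sup>2) * (k * exp (- k * a) *
      (exp (- k * a) powr ((1 + q) - 1) * ((1 - exp (- k * a)) powr ((real j + 1 + q) - (1 + q) - 1)
        / (1 - exp (- k * a) * z) powr (real j + 1))))"
      unfolding b s_def[symmetric] p by (simp add: power2_eq_square)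
  qed (use lam1_pos k m0 z in auto)
  also have "\<dots> = z ^ m * (lam1 * k / mu2\<^sup>2) * (Beta (real j + 1 + q - (1 + q)) (1 + q) * gauss_F (real j + 1) (1 + q) (real j + 1 + q) z)"
    using q j by (subst Beta_times_gauss_F) auto
  finally show ?thesis by (simp add: k_def q_def z_def m)
qed

text \<open>For \<open>growth = 0\<close> the function \<open>mean_integral\<close> is the identity
  and the linear substitution \<open>s = lam2 * a\<close> suffices. It keeps the half line, hence
  \<open>confluent_U\<close>, whose factor \<open>1 / Gamma\<close> cancels against
  \<open>Gamma (real j)\<close>.\<close>

lemma limit_prob_critical:
  assumes "lam2 = mu2" and j: "j \<ge> 1"
  shows "limit_prob j = lam1 / lam2 * Gamma (real j) * confluent_U (real j) 0 (lam1 / lam2)"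
proof -
  obtain m where m: "j = Suc m" using j by (cases j) auto
  have "limit_prob j = lam1 / lam2 * integral {0..}
      (\<lambda>s. exp (- (lam1 / lam2) * s) * s powr (real j - 1) * (1 + s) powr (0 - real j - 1))"
    unfolding limit_prob_def
  proof (rule integral_change_of_variables_half_line[where g = "\<lambda>a. lam2 * a" and g' = "\<lambda>_. lam2",
        OF _ _ _ _ limit_prob_integrand])
    show "(*) lam2 ` {0<..} = interior {0..}"
    proof -
      have "s \<in> (*) lam2 ` {0<..}" if "s > 0" for s
        using that lam2_pos by (intro image_eqI[of _ _ "s / lam2"]) auto
      then show ?thesis using lam2_pos by (auto simp: interior_real_atLeast)
    qed
    fix a :: real assume a: "a > 0"
    have la: "lam2 * a > 0" using a lam2_pos by simp
    have p: "(lam2 * a) powr (real j - 1) = (lam2 * a) ^ m"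
      using powr_realpow[OF la, of m] by (simp add: m)
    have p2: "(1 + lam2 * a) powr (0 - real j - 1) = 1 / (1 + lam2 * a) ^ (m + 2)"
    proof -
      have "(1 + lam2 * a) powr (0 - real j - 1) = (1 + lam2 * a) powr (- real (m + 2))"
        by (simp add: m)
      then show ?thesis using powr_realpow[of "1 + lam2 * a" "m + 2"] la
        by (simp only: powr_minus_divide)
    qed
    have b: "bd_prob j a = (lam2 * a) ^ m / (1 + lam2 * a) ^ (m + 2)"
      unfolding bd_prob_def mean_integral_def using assms by (simp add: m)
    show "lam1 * exp (- lam1 * a) * bd_prob j a = lam1 / lam2 * (\<bar>lam2\<bar> * (exp (- (lam1 / lam2) * (lam2 * a)) *
        (lam2 * a) powr (real j - 1) * (1 + lam2 * a) powr (0 - real j - 1)))"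
      unfolding b p p2 using lam2_pos by simp
  qed (use lam1_pos lam2_pos in \<open>auto intro!: derivative_eq_intros inj_onI\<close>)
  moreover have "Gamma (real j) > 0" using j by (intro Gamma_real_pos) auto
  ultimately show ?thesis by (simp add: confluent_U_def)
qed

text \<open>Integrate by parts, using that \<open>mu2 * bd_prob 1\<close> is the derivative of \<open>bd_prob 0\<close>.\<close>

lemma limit_prob_0_eq: "lam1 * limit_prob 0 = mu2 * limit_prob 1"
proof -
  have e: "((\<lambda>a. exp (- lam1 * a) * bd_prob j a) has_integral limit_prob j / lam1) {0..}" for j
    using has_integral_mult_right[OF limit_prob_has_integral[of j], of "1 / lam1"] lam1_pos
    by (simp add: mult.assoc)
  define D where "D = (\<lambda>a. mu2 * (exp (- lam1 * a) * bd_prob 1 a) - lam1 * (exp (- lam1 * a) * bd_prob 0 a))"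
  have D: "(D has_integral mu2 * (limit_prob 1 / lam1) - lam1 * (limit_prob 0 / lam1)) {0..}"
    unfolding D_def by (intro has_integral_diff has_integral_mult_right e)
  have b: "0 \<le> bd_prob j a \<and> bd_prob j a \<le> 1" if "a \<ge> 0" for j a
    using bd_prob_nonneg bd_prob_le_1 that by auto
  have "(D has_integral 0 - exp (- lam1 * 0) * bd_prob 0 0) {0..}"
  proof (rule has_integral_FTC_to_infinity)
    show "((\<lambda>a. exp (- lam1 * a) * bd_prob 0 a) has_real_derivative D a) (at a within {0..})" if "a \<ge> 0" for a
    proof -
      define g where "g = mean_integral a"
      have d: "1 + lam2 * g > 0" using bd_prob_denominator_pos[OF that] by (simp add: g_def)
      have "((\<lambda>a. mu2 * mean_integral a / (1 + lam2 * mean_integral a)) has_real_derivative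
          (mu2 * exp (growth * a) * (1 + lam2 * g) - mu2 * g * (lam2 * exp (growth * a))) / ((1 + lam2 * g) * (1 + lam2 * g)))
          (at a within {0..})"
        by (rule derivative_eq_intros refl)+ (use d in \<open>simp_all add: g_def\<close>)
      moreover have "(mu2 * exp (growth * a) * (1 + lam2 * g) - mu2 * g * (lam2 * exp (growth * a))) / ((1 + lam2 * g) * (1 + lam2 * g))
          = mu2 * bd_prob 1 a"
        by (simp add: bd_prob_def g_def power2_eq_square algebra_simps)
      ultimately have "(bd_prob 0 has_real_derivative mu2 * bd_prob 1 a) (at a within {0..})"
        by (simp add: bd_prob_def[abs_def])
      then show ?thesis
        unfolding D_def by (auto intro!: derivative_eq_intros)
    qed
    show "(\<lambda>a. exp (- lam1 * a) * (mu2 + lam1)) integrable_on {0..}"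
      using lam1_pos by (intro integrable_on_mult_left integrable_on_exp_minus_to_infinity)
    show "\<bar>D a\<bar> \<le> exp (- lam1 * a) * (mu2 + lam1)" if "a \<ge> 0" for a
    proof -
      have "\<bar>mu2 * bd_prob 1 a - lam1 * bd_prob 0 a\<bar> \<le> mu2 * 1 + lam1 * 1"
        using b[OF that, of 1] b[OF that, of 0] mult_left_mono[of "bd_prob 1 a" 1 mu2] mult_left_mono[of "bd_prob 0 a" 1 lam1]
          mult_nonneg_nonneg[of mu2 "bd_prob 1 a"] mult_nonneg_nonneg[of lam1 "bd_prob 0 a"] lam1_pos mu2_nonneg
        by linarith
      then have "exp (- lam1 * a) * \<bar>mu2 * bd_prob 1 a - lam1 * bd_prob 0 a\<bar> \<le> exp (- lam1 * a) * (mu2 + lam1)"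
        by simp
      moreover have "D a = exp (- lam1 * a) * (mu2 * bd_prob 1 a - lam1 * bd_prob 0 a)"
        by (simp add: D_def algebra_simps)
      ultimately show ?thesis by (simp add: abs_mult)
    qed
    show "((\<lambda>a. exp (- lam1 * a) * bd_prob 0 a) \<longlongrightarrow> 0) at_top"
    proof (rule Lim_null_comparison)
      show "\<forall>\<^sub>F a in at_top. norm (exp (- lam1 * a) * bd_prob 0 a) \<le> exp (- lam1 * a)"
        using eventually_ge_at_top[of 0]
        by eventually_elim (use b in \<open>auto simp: abs_mult mult_left_le\<close>)
      show "((\<lambda>a. exp (- lam1 * a)) \<longlongrightarrow> 0) at_top"
        using lam1_pos
        by (auto intro!: filterlim_compose[OF exp_at_bot] filterlim_tendsto_pos_mult_at_top filterlim_ident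
              simp: filterlim_uminus_at_bot)
    qed
  qed
  then have "(D has_integral 0) {0..}" by (simp add: bd_prob_def)
  from has_integral_unique[OF D this] show ?thesis using lam1_pos by (simp add: field_simps)
qed

text \<open>The substitution would produce the integrand factor \<open>s / (1 + s)\<close>, not the
  one in \<open>confluent_U\<close>; the relation to \<open>limit_prob 1\<close> provides the
  required form.\<close>

lemma limit_prob_0_critical:
  assumes "lam2 = mu2"
  shows "limit_prob 0 = confluent_U 1 0 (lam1 / lam2)"
  using limit_prob_0_eq limit_prob_critical[OF assms, of 1] lam1_pos lam2_pos assms by simp

end

text \<open>For \<open>lam2 < mu2\<close> and \<open>j \<ge> 1\<close> the factor established is
  \<open>(lam2 / mu2) ^ (j - 1)\<close> over \<open>mu2\<^sup>2\<close>, equivalently exponent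
  \<open>j + 1\<close> over \<open>lam2\<^sup>2\<close>. The English formula pairs exponent
  \<open>j + 1\<close> with \<open>mu2\<^sup>2\<close> and so differs by the factor
  \<open>(lam2 / mu2)\<^sup>2\<close>.\<close>

theorem theorem3:
  fixes M :: "'a measure"
    and lam1 lam2 mu2 :: real
    and d :: "nat \<Rightarrow> 'a \<Rightarrow> nat list"
    and dV :: "nat \<Rightarrow> 'a \<Rightarrow> nat"
  assumes "lam1 > 0" and "lam2 > 0" and "mu2 \<ge> 0"
    and "indegree_chain M lam1 lam2 mu2 d"
    and "\<And>t. uniform_vertex_indegree M (d t) (dV t)"
  shows "\<exists>p :: nat \<Rightarrow> real.
    (\<forall>j. (\<lambda>t. \<P>(\<omega> in M. dV t \<omega> = j)) \<longlonglongrightarrow> p j) \<and>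
    (mu2 = 0 \<longrightarrow>
       p 0 = 0 \<and>
       (\<forall>j\<ge>1. p j = lam1 / lam2 * Beta (real j) (1 + lam1 / lam2))) \<and>
    (mu2 > 0 \<and> lam2 > mu2 \<longrightarrow>
       p 0 = mu2 * lam1 / (lam2 * (lam2 - mu2)) * Beta 2 (lam1 / (lam2 - mu2)) *
               gauss_F 1 (lam1 / (lam2 - mu2)) (2 + lam1 / (lam2 - mu2)) (mu2 / lam2) \<and>
       (\<forall>j\<ge>1. p j = lam1 * (lam2 - mu2) / lam2\<^sup>2 * Beta (real j) (1 + lam1 / (lam2 - mu2)) *
               gauss_F (real j + 1) (1 + lam1 / (lam2 - mu2))
                 (real j + 1 + lam1 / (lam2 - mu2)) (mu2 / lam2))) \<and>
    (mu2 > 0 \<and> lam2 < mu2 \<longrightarrow>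
       p 0 = lam1 / (mu2 - lam2) * Beta 2 (lam1 / (mu2 - lam2)) *
               gauss_F 1 (lam1 / (mu2 - lam2)) (2 + lam1 / (mu2 - lam2)) (lam2 / mu2) \<and>
       (\<forall>j\<ge>1. p j = (lam2 / mu2) ^ (j - 1) * (lam1 * (mu2 - lam2) / mu2\<^sup>2) *
               Beta (real j) (1 + lam1 / (mu2 - lam2)) *
               gauss_F (real j + 1) (1 + lam1 / (mu2 - lam2))
                 (real j + 1 + lam1 / (mu2 - lam2)) (lam2 / mu2))) \<and>
    (mu2 > 0 \<and> lam2 = mu2 \<longrightarrow>
       p 0 = confluent_U 1 0 (lam1 / lam2) \<and>
       (\<forall>j\<ge>1. p j = lam1 / lam2 * Gamma (real j) * confluent_U (real j) 0 (lam1 / lam2)))"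
proof -
  interpret indegree_process lam1 lam2 mu2 M d
    using assms(1-4) by unfold_locales
  show ?thesis
    using prob_tendsto_limit_prob[OF assms(5)] limit_prob_0_immortal limit_prob_immortal
      limit_prob_0_supercritical limit_prob_supercritical limit_prob_0_subcritical
      limit_prob_subcritical limit_prob_0_critical limit_prob_critical
    by (intro exI[of _ limit_prob] conjI allI impI) (blast | simp)+
qed

end
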